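(* Let $\mathcal D$ be a filtered $\varphi$-module, $\mathcal B=(v_1,\dots,v_d)$ a basis adapted to the filtration, $J$ a finite interval of $\mathbb Z$ containing $]t_{HT,1},t'_{HT,d}]$, $N\ge0$, and let $(Z_n)_{n\ge N-1}$ be the sequence of $\mathcal H$-linear endomorphisms of $\mathcal H\otimes_{\mathbb Q_p}\mathcal D$ defined by $Z_{N-1}=\mathrm{Id}$ and $Z_n=(1\otimes\varphi)^{n+1}T_n(1\otimes\varphi)^{-(n+1)}Z_{n-1}$ for $n\ge N$. Then for all $n\ge N$, $Z_{n+1}\equiv Z_n\pmod{\omega_n^{J}}$ (i.e. all matrix entries of $Z_{n+1}-Z_n$ in a basis of $\mathcal D$ are divisible by $\omega_n^J$ in $\mathcal H$). For every $v\in\mathcal D$ the sequence $Z_n(v)$ converges in $\mathcal H\otimes\mathcal D$; the determinant of the limit $Z_\infty$ is equal, up to a unit of $\mathcal H$, to $\prod_{k=1}^d\Xi_N^{]t_{HT,k},t_{HT,d}]\subset J}$.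
   Context: Let $p$ be an odd prime and $u$ a topological generator of $1+p\mathbb Z_p$. $\mathcal H$ is the ring of power series in $\mathbb Q_p[[x]]$ converging on the open unit disc of $\mathbb C_p$ (Fréchet topology given by $\|f\|_\rho=\sup_{|z|_p\le\rho}|f(z)|_p$, $\rho<1$). For $f\in\mathbb Q_p[[x]]$, $f^{(j)}(x)=f(u^{-j}(1+x)-1)$; $\omega_n=(1+x)^{p^n}-1$, $\xi_n=\omega_n/\omega_{n-1}$ ($n\ge1$), $\xi_0=px$; for finite $S\subset\mathbb Z$, $\omega_n^S=\prod_{j\in S}\omega_n^{(j)}$, $\ell_n^S=\prod_{j\in S}\xi_n^{(j)}/p$ (empty product $1$). For a finite interval $J$, a subinterval $J'\subseteq J$ (possibly empty) and $n\ge1$, $\tilde\xi_n^{J'\subset J}$ is the unique polynomial of $\mathbb Q_p[x]$ of degree $<((p-1)|J'|+|J|)p^{n-1}$ with $\tilde\xi_n^{J'\subset J}\equiv\xi_n^{(j)}/p\pmod{\omega_n^{(j)}}$ ($j\in J'$) and $\equiv1\pmod{\omega_{n-1}^{(j)}}$ ($j\in J\setminus J'$); $\tilde\xi_0^{J'\subset J}=\ell_0^{J'}$; $\Xi_N^{J'\subset J}=\prod_{m\ge N}\tilde\xi_m^{J'\subset J}\in\mathcal H$ (convergent product). A filtered $\varphi$-module is a $d$-dimensional $\mathbb Q_p$-vector space $\mathcal D$ with a bijective linear $\varphi$ and a decreasing exhaustive separated filtration $\mathrm{Fil}^\bullet\mathcal D$; its Hodge–Tate weights $t_{HT,1}\le\dots\le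 t_{HT,d}$ are the $i$ with $\mathrm{Fil}^i\ne\mathrm{Fil}^{i+1}$ counted with multiplicity $\dim\mathrm{Fil}^i/\mathrm{Fil}^{i+1}$; $t_{N,1}\le\dots\le t_{N,d}$ are the $p$-adic valuations of the eigenvalues of $\varphi$; $t'_{HT,d}$ is the smallest integer $\ge t_{HT,d}$ with $t'_{HT,d}-t_{HT,1}>t_{N,d}-t_{N,1}$. A basis $(v_i)$ is adapted to the filtration if $v_i\in\mathrm{Fil}^{t_{HT,i}}\mathcal D$. For integers $a\le b$, $]a,b]=\{j\in\mathbb Z: a<j\le b\}$. For $n\ge0$, $T_n$ is the $\mathcal H$-linear endomorphism of $\mathcal H\otimes\mathcal D$ with $T_n(v_i)=\tilde\xi_n^{]t_{HT,i},t_{HT,d}]\subset J}\,v_i$. *)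

theory Defs
  imports Complex_Main "HOL-Computational_Algebra.Polynomial_FPS" "HOL-Library.Multiset"
    "Jordan_Normal_Form.Determinant" "Jordan_Normal_Form.Char_Poly"
begin

definition padic_val_rat :: "nat \<Rightarrow> rat \<Rightarrow> int" where
  "padic_val_rat p q = (case quotient_of q of (a, b) \<Rightarrow>
      int (multiplicity (int p) a) - int (multiplicity (int p) b))"

definition padic_abs_rat :: "nat \<Rightarrow> rat \<Rightarrow> real" where
  "padic_abs_rat p q = (if q = 0 then 0 else real p powr (- real_of_int (padic_val_rat p q)))"

definition vtends :: "('a \<Rightarrow> real) \<Rightarrow> (nat \<Rightarrow> 'a::ab_group_add) \<Rightarrow> 'a \<Rightarrow> bool" where
  "vtends nabs X L \<longleftrightarrow> (\<forall>e>0. \<exists>N. \<forall>n\<ge>N. nabs (X n - L) < e)"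

definition nonarch_abs :: "('a::field \<Rightarrow> real) \<Rightarrow> bool" where
  "nonarch_abs nabs \<longleftrightarrow> (\<forall>x. 0 \<le> nabs x) \<and> (\<forall>x. nabs x = 0 \<longleftrightarrow> x = 0)
     \<and> (\<forall>x y. nabs (x * y) = nabs x * nabs y) \<and> (\<forall>x y. nabs (x + y) \<le> max (nabs x) (nabs y))"

definition is_Qp :: "nat \<Rightarrow> ('k::field_char_0 \<Rightarrow> real) \<Rightarrow> bool" where
  "is_Qp p nabs \<longleftrightarrow> nonarch_abs nabs
     \<and> (\<forall>q. nabs (of_rat q) = padic_abs_rat p q)
     \<and> (\<forall>x. \<forall>e>0. \<exists>q. nabs (x - of_rat q) < e)
     \<and> (\<forall>X. (\<forall>e>0. \<exists>N. \<forall>m\<ge>N. \<forall>n\<ge>N. nabs (X m - X n) < e) \<longrightarrow> (\<exists>L. vtends nabs X L))"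

definition top_generator :: "nat \<Rightarrow> ('k::field_char_0 \<Rightarrow> real) \<Rightarrow> 'k \<Rightarrow> bool" where
  "top_generator p nabs u \<longleftrightarrow> nabs (u - 1) \<le> 1 / real p
     \<and> (\<forall>y. nabs (y - 1) \<le> 1 / real p \<longrightarrow> (\<forall>e>0. \<exists>n::int. nabs (u powi n - y) < e))"

definition is_alg_closure_valued ::
  "('k::field \<Rightarrow> real) \<Rightarrow> ('k \<Rightarrow> 'K::field) \<Rightarrow> ('K \<Rightarrow> real) \<Rightarrow> bool" where
  "is_alg_closure_valued nabs iota nabsK \<longleftrightarrow>
     (\<forall>x y. iota (x + y) = iota x + iota y) \<and> (\<forall>x y. iota (x * y) = iota x * iota y)
     \<and> iota 1 = 1 \<and> nonarch_abs nabsK \<and> (\<forall>x. nabsK (iota x) = nabs x)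
     \<and> (\<forall>q::'K poly. 0 < degree q \<longrightarrow> (\<exists>r. poly q r = 0))
     \<and> (\<forall>y. \<exists>q::'k poly. q \<noteq> 0 \<and> poly (map_poly iota q) y = 0)"

definition inH :: "('k::field \<Rightarrow> real) \<Rightarrow> 'k fps \<Rightarrow> bool" where
  "inH nabs f \<longleftrightarrow> (\<forall>r. 0 \<le> r \<and> r < 1 \<longrightarrow> (\<lambda>n. nabs (fps_nth f n) * r ^ n) \<longlonglongrightarrow> 0)"

definition Hnorm :: "('k::field \<Rightarrow> real) \<Rightarrow> real \<Rightarrow> 'k fps \<Rightarrow> real" where
  "Hnorm nabs r f = (SUP n. nabs (fps_nth f n) * r ^ n)"

definition Hconv :: "('k::field \<Rightarrow> real) \<Rightarrow> (nat \<Rightarrow> 'k fps) \<Rightarrow> 'k fps \<Rightarrow> bool" where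
  "Hconv nabs F f \<longleftrightarrow> (\<forall>n. inH nabs (F n)) \<and> inH nabs f
     \<and> (\<forall>r. 0 \<le> r \<and> r < 1 \<longrightarrow> (\<lambda>n. Hnorm nabs r (F n - f)) \<longlonglongrightarrow> 0)"

definition Hdvd :: "('k::field \<Rightarrow> real) \<Rightarrow> 'k fps \<Rightarrow> 'k fps \<Rightarrow> bool" where
  "Hdvd nabs a b \<longleftrightarrow> (\<exists>c. inH nabs c \<and> b = a * c)"

definition Hunit :: "('k::field \<Rightarrow> real) \<Rightarrow> 'k fps \<Rightarrow> bool" where
  "Hunit nabs f \<longleftrightarrow> inH nabs f \<and> (\<exists>g. inH nabs g \<and> f * g = 1)"

definition twist :: "'k::field \<Rightarrow> int \<Rightarrow> 'k poly \<Rightarrow> 'k poly" where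
  "twist u j f = pcompose f [: u powi (-j) - 1, u powi (-j) :]"

definition omega :: "nat \<Rightarrow> nat \<Rightarrow> 'k::field poly" where
  "omega p n = [:1, 1:] ^ (p ^ n) - 1"

definition xi :: "nat \<Rightarrow> nat \<Rightarrow> 'k::field poly" where
  "xi p n = (if n = 0 then [:0, of_nat p:] else omega p n div omega p (n - 1))"

definition omegaS :: "nat \<Rightarrow> 'k::field \<Rightarrow> nat \<Rightarrow> int set \<Rightarrow> 'k poly" where
  "omegaS p u n S = (\<Prod>j\<in>S. twist u j (omega p n))"

definition ellS :: "nat \<Rightarrow> 'k::field \<Rightarrow> nat \<Rightarrow> int set \<Rightarrow> 'k poly" where
  "ellS p u n S = (\<Prod>j\<in>S. Polynomial.smult (1 / of_nat p) (twist u j (xi p n)))"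

definition xitilde :: "nat \<Rightarrow> 'k::field \<Rightarrow> nat \<Rightarrow> int set \<Rightarrow> int set \<Rightarrow> 'k poly" where
  "xitilde p u n J' J = (if n = 0 then ellS p u 0 J' else
     (THE P. degree P < ((p - 1) * card J' + card J) * p ^ (n - 1)
        \<and> (\<forall>j\<in>J'. twist u j (omega p n) dvd (P - Polynomial.smult (1 / of_nat p) (twist u j (xi p n))))
        \<and> (\<forall>j\<in>J - J'. twist u j (omega p (n - 1)) dvd (P - 1))))"

definition Xi :: "nat \<Rightarrow> ('k::field \<Rightarrow> real) \<Rightarrow> 'k \<Rightarrow> nat \<Rightarrow> int set \<Rightarrow> int set \<Rightarrow> 'k fps" where
  "Xi p nabs u N J' J = (THE f. Hconv nabs
      (\<lambda>M. fps_of_poly (\<Prod>m\<in>{N..M}. xitilde p u m J' J)) f)"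

definition is_filtration :: "('k::field \<Rightarrow> 'v::ab_group_add \<Rightarrow> 'v) \<Rightarrow> (int \<Rightarrow> 'v set) \<Rightarrow> bool" where
  "is_filtration scale Fil \<longleftrightarrow> (\<forall>i. module.subspace scale (Fil i))
     \<and> (\<forall>i. Fil (i + 1) \<subseteq> Fil i) \<and> (\<Union>i. Fil i) = UNIV \<and> (\<Inter>i. Fil i) = {0}"

definition HT_mset :: "('k::field \<Rightarrow> 'v::ab_group_add \<Rightarrow> 'v) \<Rightarrow> (int \<Rightarrow> 'v set) \<Rightarrow> int multiset" where
  "HT_mset scale Fil = (\<Sum>i\<in>{i. Fil i \<noteq> Fil (i + 1)}.
      replicate_mset (vector_space.dim scale (Fil i) - vector_space.dim scale (Fil (i + 1))) i)"

definition tHT :: "('k::field \<Rightarrow> 'v::ab_group_add \<Rightarrow> 'v) \<Rightarrow> (int \<Rightarrow> 'v set) \<Rightarrow> nat \<Rightarrow> int" where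
  "tHT scale Fil k = sorted_list_of_multiset (HT_mset scale Fil) ! (k - 1)"

definition mat_of_map :: "('k::field \<Rightarrow> 'v::ab_group_add \<Rightarrow> 'v) \<Rightarrow> nat \<Rightarrow> (nat \<Rightarrow> 'v) \<Rightarrow> ('v \<Rightarrow> 'v) \<Rightarrow> 'k mat" where
  "mat_of_map scale d v f = mat d d (\<lambda>(i, j).
      module.representation scale (v ` {1..d}) (f (v (j + 1))) (v (i + 1)))"

definition newton_vals :: "nat \<Rightarrow> ('k::field \<Rightarrow> 'K::field) \<Rightarrow> ('K \<Rightarrow> real) \<Rightarrow> 'k mat \<Rightarrow> real set" where
  "newton_vals p iota nabsK A =
     (\<lambda>l. - log (real p) (nabsK l)) ` {l. poly (map_poly iota (char_poly A)) l = 0}"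

definition tHT'_d :: "int \<Rightarrow> int \<Rightarrow> real set \<Rightarrow> int" where
  "tHT'_d t1 td NV = (LEAST m::int. td \<le> m \<and> real_of_int (m - t1) > Max NV - Min NV)"

definition Tmat :: "nat \<Rightarrow> 'k::field \<Rightarrow> nat \<Rightarrow> (nat \<Rightarrow> int) \<Rightarrow> int set \<Rightarrow> nat \<Rightarrow> 'k fps mat" where
  "Tmat p u d t J n = mat d d (\<lambda>(i, j). if i = j
      then fps_of_poly (xitilde p u n {t (i + 1)<..t d} J) else 0)"

definition Zstep :: "nat \<Rightarrow> 'k::field \<Rightarrow> ('k \<Rightarrow> 'v::ab_group_add \<Rightarrow> 'v) \<Rightarrow> nat \<Rightarrow> (nat \<Rightarrow> 'v)
     \<Rightarrow> ('v \<Rightarrow> 'v) \<Rightarrow> (nat \<Rightarrow> int) \<Rightarrow> int set \<Rightarrow> nat \<Rightarrow> 'k fps mat" where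
  "Zstep p u scale d v phi t J n =
     map_mat fps_const (mat_of_map scale d v (compow (n + 1) phi)) * Tmat p u d t J n
     * map_mat fps_const (mat_of_map scale d v (compow (n + 1) (Hilbert_Choice.inv phi)))"

text \<open>Zseq ... N n = Z_n for n >= N - 1, with Z_{N-1} = Id.\<close>
primrec Zseq :: "nat \<Rightarrow> 'k::field \<Rightarrow> ('k \<Rightarrow> 'v::ab_group_add \<Rightarrow> 'v) \<Rightarrow> nat \<Rightarrow> (nat \<Rightarrow> 'v)
     \<Rightarrow> ('v \<Rightarrow> 'v) \<Rightarrow> (nat \<Rightarrow> int) \<Rightarrow> int set \<Rightarrow> nat \<Rightarrow> nat \<Rightarrow> 'k fps mat" where
  "Zseq p u scale d v phi t J N 0 =
     (if N = 0 then Zstep p u scale d v phi t J 0 * 1\<^sub>m d else 1\<^sub>m d)"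
| "Zseq p u scale d v phi t J N (Suc n) =
     (if N \<le> Suc n then Zstep p u scale d v phi t J (Suc n) * Zseq p u scale d v phi t J N n else 1\<^sub>m d)"

end

theory Submission
  imports Defs
begin

text \<open>For \<open>n \<ge> 1\<close> the polynomial \<open>xitilde\<close> has the form \<open>1 + \<omega>\<^sub>n\<^sub>-\<^sub>1\<^sup>J K\<close>, where the coefficients of
  \<open>K\<close> are bounded independently of \<open>n\<close>: up to sign, \<open>K\<close> is the reduced inverse of \<open>\<omega>\<^sub>n\<^sub>-\<^sub>1\<^sup>J\<close> modulo the product of
  the twists of \<open>\<xi>\<^sub>n\<close>, which can be written down explicitly. Since \<open>\<omega>\<^sub>n\<^sup>J\<close> has norm \<open>O(p ^ (- n card J))\<close>
  on each closed disc of radius \<open>r < 1\<close>, while conjugation by the \<open>n\<close>-th power of \<open>\<phi>\<close> costs a factor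
  \<open>O(p ^ (n \<Delta>))\<close> with \<open>\<Delta> = Max NV - Min NV < card J\<close>, the factors of the infinite product tend
  to the identity, and the product converges because the norms are ultrametric. Each
  factor of \<open>Z\<^sub>n\<close> has determinant \<open>det T\<^sub>n\<close>, so the determinant identity holds with
  unit \<open>1\<close>.\<close>

section \<open>Power series on the open unit disc\<close>

text \<open>Two radii share the work. The cofactor \<open>K\<close> is measured at radius 1, in the
  Gauss norm, where division by an integral polynomial with unit leading coefficient loses nothing;
  the decay of \<open>omegaS\<close> is available only at radii \<open>r < 1\<close>, since
  \<open>om j m\<close> has Gauss norm 1. What bounds \<open>K\<close> uniformly is that (1+x)^(p^m)
  becomes a constant modulo a twist of \<open>omega p m\<close>: a twist of the next
  \<open>xi\<close> turns into a geometric sum of p terms with ratio near 1, of absolute value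
  exactly 1/p at every level. The inequality \<Delta> < card J is the purpose of
  \<open>tHT'_d\<close>: by its definition the interval from the first weight to
  \<open>tHT'_d\<close>, which lies in \<open>J\<close>, has more than \<Delta> elements. The
  eigenvalues of \<phi> lie in the algebraic closure while the matrices have entries in the base
  field, so the growth of powers is estimated over the closure and carried back along the isometric
  embedding \<open>iota\<close>.\<close>

locale nonarch_field =
  fixes nabs :: "'k::field \<Rightarrow> real"
  assumes nonarch: "nonarch_abs nabs"
begin

lemma nabs_nonneg [simp]: "0 \<le> nabs x"
  using nonarch by (simp add: nonarch_abs_def)

lemma nabs_eq_0_iff [simp]: "nabs x = 0 \<longleftrightarrow> x = 0"
  using nonarch by (simp add: nonarch_abs_def)

lemma nabs_pos_iff [simp]: "0 < nabs x \<longleftrightarrow> x \<noteq> 0"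
  using nabs_nonneg[of x] nabs_eq_0_iff[of x] by linarith

lemma nabs_mult: "nabs (x * y) = nabs x * nabs y"
  using nonarch by (simp add: nonarch_abs_def)

lemma nabs_add: "nabs (x + y) \<le> max (nabs x) (nabs y)"
  using nonarch by (simp add: nonarch_abs_def)

lemma nabs_0 [simp]: "nabs 0 = 0"
  by simp

lemma nabs_1 [simp]: "nabs 1 = 1"
  using nabs_mult[of 1 1] by simp

lemma nabs_minus [simp]: "nabs (- x) = nabs x"
proof -
  have "nabs (-1) * nabs (-1) = 1"
    using nabs_mult[of "-1" "-1"] by simp
  hence "nabs (-1) = 1"
    using nabs_nonneg[of "-1"] by (metis abs_of_nonneg abs_mult_self_eq real_sqrt_abs2 real_sqrt_one)
  thus ?thesis
    using nabs_mult[of "-1" x] by simp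
qed

lemma nabs_diff: "nabs (x - y) \<le> max (nabs x) (nabs y)"
  using nabs_add[of x "- y"] by simp

lemma nabs_diff_commute: "nabs (x - y) = nabs (y - x)"
  using nabs_minus[of "x - y"] by simp

lemma nabs_power: "nabs (x ^ n) = nabs x ^ n"
  by (induction n) (simp_all add: nabs_mult)

lemma nabs_inverse: "nabs (inverse x) = inverse (nabs x)"
proof (cases "x = 0")
  case False
  then have "nabs x * nabs (inverse x) = 1"
    using nabs_mult[of x "inverse x"] by simp
  thus ?thesis by (simp add: inverse_unique)
qed simp

lemma nabs_divide: "nabs (x / y) = nabs x / nabs y"
  by (simp add: divide_inverse nabs_mult nabs_inverse)

lemma nabs_prod: "nabs (prod f A) = (\<Prod>i\<in>A. nabs (f i))"
  by (induction A rule: infinite_finite_induct) (simp_all add: nabs_mult)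

lemma nabs_sum_le:
  assumes "\<And>i. i \<in> A \<Longrightarrow> nabs (f i) \<le> B" "0 \<le> B"
  shows "nabs (sum f A) \<le> B"
  using assms
proof (induction A rule: infinite_finite_induct)
  case (insert a A)
  thus ?case using nabs_add[of "f a" "sum f A"] by fastforce
qed simp_all

text \<open>The isosceles principle: \<open>x = (x - y) + y\<close> and
  \<open>y = x - (x - y)\<close> bound each absolute value by the other, because
  \<open>x - y\<close> is too small to be the maximum.\<close>

lemma nabs_eq_of_diff_less:
  assumes "nabs (x - y) < nabs y"
  shows "nabs x = nabs y"
  using nabs_add[of "x - y" y] nabs_diff[of x "x - y"] assms by auto

text \<open>Says that the norm on the closed disc of radius \<open>r\<close> is at most
  \<open>B\<close>. As a predicate on coefficients it needs no finite supremum and also makes sense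
  at \<open>r = 1\<close>, where it bounds the Gauss norm of a polynomial.\<close>

definition rbd :: "real \<Rightarrow> real \<Rightarrow> 'k fps \<Rightarrow> bool" where
  "rbd r B f \<longleftrightarrow> (\<forall>n. nabs (fps_nth f n) * r ^ n \<le> B)"

lemma rbdD: "rbd r B f \<Longrightarrow> nabs (fps_nth f n) * r ^ n \<le> B"
  by (simp add: rbd_def)

lemma rbd_mono: "rbd r A f \<Longrightarrow> A \<le> B \<Longrightarrow> rbd r B f"
  unfolding rbd_def by (meson order_trans)

lemma rbd_nonneg: "rbd r B f \<Longrightarrow> 0 \<le> B"
  using rbdD[of r B f 0] order_trans[OF nabs_nonneg[of "fps_nth f 0"]] by simp

lemma rbd_antimono:
  assumes "rbd r B f" "0 \<le> s" "s \<le> r"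
  shows "rbd s B f"
  unfolding rbd_def
proof
  fix n
  have "nabs (fps_nth f n) * s ^ n \<le> nabs (fps_nth f n) * r ^ n"
    using assms by (intro mult_left_mono power_mono) auto
  thus "nabs (fps_nth f n) * s ^ n \<le> B"
    using rbdD[OF assms(1)] order_trans by blast
qed

lemma rbd_0 [simp]: "rbd r B 0 \<longleftrightarrow> 0 \<le> B"
  by (simp add: rbd_def)

lemma rbd_const [simp]: "0 \<le> r \<Longrightarrow> rbd r B (fps_const c) \<longleftrightarrow> nabs c \<le> B"
proof
  assume "0 \<le> r" "nabs c \<le> B"
  moreover from this have "0 \<le> B" using nabs_nonneg order_trans by blast
  ultimately show "rbd r B (fps_const c)"
    unfolding rbd_def by auto
qed (auto dest: rbdD[of _ _ _ 0])

lemma rbd_1 [simp]: "0 \<le> r \<Longrightarrow> rbd r B 1 \<longleftrightarrow> 1 \<le> B"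
  using rbd_const[of r B 1] by simp

lemma rbd_uminus [simp]: "rbd r B (- f) \<longleftrightarrow> rbd r B f"
  by (simp add: rbd_def)

lemma rbd_add:
  assumes "rbd r B f" "rbd r B g" "0 \<le> r"
  shows "rbd r B (f + g)"
  unfolding rbd_def
proof
  fix n
  have "nabs (fps_nth (f + g) n) * r ^ n \<le> max (nabs (fps_nth f n)) (nabs (fps_nth g n)) * r ^ n"
    using nabs_add assms(3) by (intro mult_right_mono) auto
  also have "\<dots> \<le> B"
    using rbdD[OF assms(1), of n] rbdD[OF assms(2), of n] by (simp add: max_def)
  finally show "nabs (fps_nth (f + g) n) * r ^ n \<le> B" .
qed

lemma rbd_diff: "rbd r B f \<Longrightarrow> rbd r B g \<Longrightarrow> 0 \<le> r \<Longrightarrow> rbd r B (f - g)"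
  using rbd_add[of r B f "- g"] by simp

lemma rbd_sum:
  assumes "\<And>i. i \<in> A \<Longrightarrow> rbd r B (f i)" "0 \<le> r" "0 \<le> B"
  shows "rbd r B (sum f A)"
  using assms by (induction A rule: infinite_finite_induct) (auto intro!: rbd_add)

lemma rbd_mult:
  assumes "rbd r A f" "rbd r B g" "0 \<le> r"
  shows "rbd r (A * B) (f * g)"
  unfolding rbd_def
proof
  fix n
  have 0: "0 \<le> A" "0 \<le> B"
    using assms rbd_nonneg by auto
  show "nabs (fps_nth (f * g) n) * r ^ n \<le> A * B"
  \<comment> \<open>At radius 0 only the constant coefficients count, as \<open>0 ^ 0 = 1\<close>;
    for \<open>r > 0\<close> the weight splits as \<open>r ^ i * r ^ (n - i)\<close> on each term of
    the convolution.\<close>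
  proof (cases "r = 0")
    case True
    thus ?thesis
      using mult_mono[OF rbdD[OF assms(1), of 0] rbdD[OF assms(2), of 0]] 0
      by (cases n) (auto simp: nabs_mult)
  next
    case False
    with assms have r: "r > 0" by simp
    have "nabs (fps_nth (f * g) n) \<le> A * B / r ^ n"
      unfolding fps_mult_nth
    proof (rule nabs_sum_le)
      fix i assume i: "i \<in> {0..n}"
      have "(nabs (fps_nth f i) * r ^ i) * (nabs (fps_nth g (n - i)) * r ^ (n - i)) \<le> A * B"
        using assms r 0 by (intro mult_mono rbdD) auto
      moreover have "r ^ n = r ^ i * r ^ (n - i)"
        using i by (simp flip: power_add)
      ultimately show "nabs (fps_nth f i * fps_nth g (n - i)) \<le> A * B / r ^ n"
        using r by (simp add: nabs_mult field_simps)
    qed (use 0 r in auto)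
    thus ?thesis using r by (simp add: field_simps)
  qed
qed

lemma rbd_prod:
  assumes "\<And>i. i \<in> A \<Longrightarrow> rbd r (B i) (f i)" "0 \<le> r"
  shows "rbd r (\<Prod>i\<in>A. B i) (\<Prod>i\<in>A. f i)"
  using assms by (induction A rule: infinite_finite_induct) (auto intro!: rbd_mult)

lemma rbd_power: "rbd r B f \<Longrightarrow> 0 \<le> r \<Longrightarrow> rbd r (B ^ n) (f ^ n)"
  by (induction n) (auto intro!: rbd_mult)

lemma rbd_fps_of_poly_ex: "\<exists>B. rbd r B (fps_of_poly q)"
proof
  let ?S = "(\<lambda>n. nabs (coeff q n) * r ^ n) ` {..degree q}"
  show "rbd r (max 0 (Max ?S)) (fps_of_poly q)"
    unfolding rbd_def
  proof
    fix n
    show "nabs (fps_nth (fps_of_poly q) n) * r ^ n \<le> max 0 (Max ?S)"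
    proof (cases "n \<le> degree q")
      case True
      hence "nabs (coeff q n) * r ^ n \<le> Max ?S"
        by (intro Max_ge) auto
      thus ?thesis by simp
    qed (simp add: coeff_eq_0)
  qed
qed

text \<open>A null sequence is bounded; conversely, a bound at a radius \<open>s\<close> with
  \<open>r < s < 1\<close> makes the terms at radius \<open>r\<close> decay like
  \<open>(r / s) ^ n\<close>. The disc being open leaves room for such an \<open>s\<close>.\<close>

lemma inH_iff: "inH nabs f \<longleftrightarrow> (\<forall>r. 0 \<le> r \<and> r < 1 \<longrightarrow> (\<exists>B. rbd r B f))"
proof (intro iffI allI impI)
  fix r :: real
  assume "inH nabs f" "0 \<le> r \<and> r < 1"
  hence "(\<lambda>n. nabs (fps_nth f n) * r ^ n) \<longlonglongrightarrow> 0"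
    unfolding inH_def by blast
  hence "Bseq (\<lambda>n. nabs (fps_nth f n) * r ^ n)"
    by (simp add: convergentI convergent_imp_Bseq)
  then obtain B where "\<And>n. norm (nabs (fps_nth f n) * r ^ n) \<le> B"
    unfolding Bseq_def by blast
  thus "\<exists>B. rbd r B f"
    unfolding rbd_def by (metis abs_ge_self order_trans real_norm_def)
next
  assume *: "\<forall>r. 0 \<le> r \<and> r < 1 \<longrightarrow> (\<exists>B. rbd r B f)"
  show "inH nabs f"
    unfolding inH_def
  proof (intro allI impI)
    fix r :: real assume r: "0 \<le> r \<and> r < 1"
    define s where "s = (r + 1) / 2"
    have s: "0 < s" "s < 1" "r < s" using r by (auto simp: s_def)
    obtain B where B: "rbd s B f" using * s by force
    have "(\<lambda>n. B * (r / s) ^ n) \<longlonglongrightarrow> 0"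
      using LIMSEQ_power_zero[of "r / s"] s r tendsto_mult_right_zero by fastforce
    from tendsto_const this show "(\<lambda>n. nabs (fps_nth f n) * r ^ n) \<longlonglongrightarrow> 0"
    proof (rule real_tendsto_sandwich[rotated 2]; intro always_eventually allI)
      fix n
      have "nabs (fps_nth f n) * r ^ n = (nabs (fps_nth f n) * s ^ n) * (r / s) ^ n"
        using s by (simp add: power_divide)
      also have "\<dots> \<le> B * (r / s) ^ n"
        using s r by (intro mult_right_mono rbdD[OF B]) auto
      finally show "nabs (fps_nth f n) * r ^ n \<le> B * (r / s) ^ n" .
    qed (use r in simp)
  qed
qed

lemma inH_0 [simp]: "inH nabs 0" and inH_1 [simp]: "inH nabs 1"
  and inH_const [simp]: "inH nabs (fps_const c)"
  unfolding inH_iff by (auto intro: exI[of _ 1] exI[of _ "nabs c"])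

lemma inH_fps_of_poly [simp]: "inH nabs (fps_of_poly q)"
  unfolding inH_iff using rbd_fps_of_poly_ex by blast

lemma inH_mult: "inH nabs f \<Longrightarrow> inH nabs g \<Longrightarrow> inH nabs (f * g)"
  unfolding inH_iff using rbd_mult by blast

lemma inH_add: "inH nabs f \<Longrightarrow> inH nabs g \<Longrightarrow> inH nabs (f + g)"
  unfolding inH_iff by (meson rbd_add rbd_mono max.cobounded1 max.cobounded2)

lemma inH_uminus: "inH nabs f \<Longrightarrow> inH nabs (- f)"
  unfolding inH_iff by simp

lemma inH_diff: "inH nabs f \<Longrightarrow> inH nabs g \<Longrightarrow> inH nabs (f - g)"
  using inH_add[of f "- g"] inH_uminus[of g] by simp

lemma inH_sum: "(\<And>i. i \<in> A \<Longrightarrow> inH nabs (f i)) \<Longrightarrow> inH nabs (sum f A)"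
  by (induction A rule: infinite_finite_induct) (auto intro: inH_add)

lemma Hdvd_mult_left: "Hdvd nabs a b \<Longrightarrow> inH nabs c \<Longrightarrow> Hdvd nabs a (c * b)"
  unfolding Hdvd_def by (metis inH_mult mult.left_commute)

lemma Hdvd_sum: "(\<And>i. i \<in> A \<Longrightarrow> Hdvd nabs a (f i)) \<Longrightarrow> Hdvd nabs a (sum f A)"
proof (induction A rule: infinite_finite_induct)
  case (insert x A)
  then obtain c1 c2 where "inH nabs c1" "f x = a * c1" "inH nabs c2" "sum f A = a * c2"
    unfolding Hdvd_def by (meson insertCI)
  with insert show ?case
    unfolding Hdvd_def by (auto intro!: exI[of _ "c1 + c2"] inH_add simp: distrib_left)
qed (auto simp: Hdvd_def intro: exI[of _ 0])

lemma Hnorm_le_iff: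
  assumes "inH nabs f" "0 \<le> r" "r < 1"
  shows "Hnorm nabs r f \<le> e \<longleftrightarrow> rbd r e f"
proof -
  obtain B where "rbd r B f" using assms inH_iff by blast
  hence "bdd_above (range (\<lambda>n. nabs (fps_nth f n) * r ^ n))"
    unfolding rbd_def by (auto intro!: bdd_aboveI2)
  thus ?thesis
    unfolding Hnorm_def rbd_def by (simp add: cSUP_le_iff)
qed

text \<open>From here on convergence is handled through \<open>rbd\<close> alone. The strict bound
  in the definition of a limit and the weak bound of \<open>rbd\<close> are exchanged by passing to
  a smaller \<open>e\<close>.\<close>

lemma Hconv_iff:
  "Hconv nabs F f \<longleftrightarrow> (\<forall>n. inH nabs (F n)) \<and> inH nabs f
     \<and> (\<forall>r e. 0 \<le> r \<and> r < 1 \<and> 0 < e \<longrightarrow> (\<exists>N. \<forall>n\<ge>N. rbd r e (F n - f)))"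
proof (cases "(\<forall>n. inH nabs (F n)) \<and> inH nabs f")
  case True
  hence H: "inH nabs (F n - f)" for n by (simp add: inH_diff)
  have "(\<lambda>n. Hnorm nabs r (F n - f)) \<longlonglongrightarrow> 0 \<longleftrightarrow>
      (\<forall>e>0. \<exists>N. \<forall>n\<ge>N. rbd r e (F n - f))" if r: "0 \<le> r" "r < 1" for r
  proof -
    have le: "Hnorm nabs r (F n - f) \<le> e \<longleftrightarrow> rbd r e (F n - f)" for n e
      using Hnorm_le_iff[OF H r] .
    have "0 \<le> Hnorm nabs r (F n - f)" for n
      using le[of n "Hnorm nabs r (F n - f)"] rbd_nonneg by blast
    hence "(\<lambda>n. Hnorm nabs r (F n - f)) \<longlonglongrightarrow> 0 \<longleftrightarrow>
        (\<forall>e>0. \<exists>N. \<forall>n\<ge>N. Hnorm nabs r (F n - f) < e)"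
      by (simp add: LIMSEQ_iff)
    also have "\<dots> \<longleftrightarrow> (\<forall>e>0. \<exists>N. \<forall>n\<ge>N. Hnorm nabs r (F n - f) \<le> e)"
      by (meson dense le_less_trans less_imp_le)
    finally show ?thesis by (simp add: le)
  qed
  thus ?thesis unfolding Hconv_def using True by blast
qed (auto simp: Hconv_def)

lemma Hconv_rbd:
  "Hconv nabs F f \<Longrightarrow> 0 \<le> r \<Longrightarrow> r < 1 \<Longrightarrow> 0 < e \<Longrightarrow> \<exists>N. \<forall>n\<ge>N. rbd r e (F n - f)"
  by (simp add: Hconv_iff)

lemma Hconv_const: "inH nabs f \<Longrightarrow> Hconv nabs (\<lambda>n. f) f"
  by (simp add: Hconv_iff)

lemma Hconv_add:
  assumes "Hconv nabs F f" "Hconv nabs G g"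
  shows "Hconv nabs (\<lambda>n. F n + G n) (f + g)"
  unfolding Hconv_iff
proof (intro conjI allI impI)
  fix r e :: real assume r: "0 \<le> r \<and> r < 1 \<and> 0 < e"
  obtain N1 N2 where N: "\<And>n. n \<ge> N1 \<Longrightarrow> rbd r e (F n - f)" "\<And>n. n \<ge> N2 \<Longrightarrow> rbd r e (G n - g)"
    using assms r unfolding Hconv_iff by meson
  show "\<exists>N. \<forall>n\<ge>N. rbd r e (F n + G n - (f + g))"
  proof (intro exI allI impI)
    fix n assume "n \<ge> max N1 N2"
    with rbd_add[of r e "F n - f" "G n - g"] N r show "rbd r e (F n + G n - (f + g))"
      by (simp add: algebra_simps)
  qed
qed (use assms in \<open>auto simp: Hconv_iff intro: inH_add\<close>)

lemma Hconv_mult: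
  assumes "Hconv nabs F f" "Hconv nabs G g"
  shows "Hconv nabs (\<lambda>n. F n * G n) (f * g)"
  unfolding Hconv_iff
proof (intro conjI allI impI)
  fix r e :: real assume r: "0 \<le> r \<and> r < 1 \<and> 0 < e"
  obtain A B where AB: "rbd r A f" "rbd r B g"
    using assms r unfolding Hconv_iff inH_iff by meson
  define C where "C = max 1 (max A B)"
  have C: "rbd r C f" "rbd r C g" "C \<ge> 1"
    using rbd_mono[OF AB(1)] rbd_mono[OF AB(2)] by (auto simp: C_def)
  \<comment> \<open>The \<open>1\<close> keeps \<open>G n\<close> bounded by \<open>C\<close>
    together with \<open>g\<close>, since \<open>C \<ge> 1\<close>; the quotient makes both error
    terms of the product at most \<open>e\<close>.\<close>
  define e' where "e' = min 1 (e / C)"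
  have e': "0 < e'" "e' \<le> C" "e' * C \<le> e"
    using r C(3) by (auto simp: e'_def min_le_iff_disj min_mult_distrib_right)
  obtain N1 N2 where N: "\<And>n. n \<ge> N1 \<Longrightarrow> rbd r e' (F n - f)" "\<And>n. n \<ge> N2 \<Longrightarrow> rbd r e' (G n - g)"
    using assms r e' unfolding Hconv_iff by meson
  show "\<exists>N. \<forall>n\<ge>N. rbd r e (F n * G n - f * g)"
  proof (intro exI allI impI)
    fix n assume n: "n \<ge> max N1 N2"
    have "rbd r C (G n - g)"
      using N(2)[of n] n e' rbd_mono by auto
    hence "rbd r C (G n - g + g)"
      using r C(2) by (intro rbd_add) auto
    hence "rbd r (e' * C) ((F n - f) * G n)"
      using N n r by (intro rbd_mult) auto
    moreover have "rbd r (e' * C) ((G n - g) * f)"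
      using N n r C by (intro rbd_mult) auto
    ultimately have "rbd r (e' * C) ((F n - f) * G n + (G n - g) * f)"
      using r by (intro rbd_add) auto
    also have "(F n - f) * G n + (G n - g) * f = F n * G n - f * g"
      by (simp add: algebra_simps)
    finally show "rbd r e (F n * G n - f * g)"
      using e' rbd_mono by blast
  qed
qed (use assms in \<open>auto simp: Hconv_iff intro: inH_mult\<close>)

lemma Hconv_sum:
  "(\<And>i. i \<in> A \<Longrightarrow> Hconv nabs (F i) (f i)) \<Longrightarrow> Hconv nabs (\<lambda>n. \<Sum>i\<in>A. F i n) (\<Sum>i\<in>A. f i)"
proof (induction A rule: infinite_finite_induct)
  case (insert x A)
  then show ?case using Hconv_add[of "F x" "f x" "\<lambda>n. \<Sum>i\<in>A. F i n" "\<Sum>i\<in>A. f i"] by simp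
qed (simp_all add: Hconv_const)

lemma Hconv_prod:
  "(\<And>i. i \<in> A \<Longrightarrow> Hconv nabs (F i) (f i)) \<Longrightarrow> Hconv nabs (\<lambda>n. \<Prod>i\<in>A. F i n) (\<Prod>i\<in>A. f i)"
proof (induction A rule: infinite_finite_induct)
  case (insert x A)
  then show ?case using Hconv_mult[of "F x" "f x" "\<lambda>n. \<Prod>i\<in>A. F i n" "\<Prod>i\<in>A. f i"] by simp
qed (simp_all add: Hconv_const)

text \<open>A single positive radius separates power series, since each coefficient is dominated by
  the norm there. This gives sense to the \<open>THE\<close> in \<open>Xi\<close> and reduces the
  determinant identity to a comparison of limits.\<close>

lemma Hconv_unique:
  assumes "Hconv nabs F f" "Hconv nabs F g"
  shows "f = g"
proof (rule fps_ext, rule ccontr)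
  fix k assume neq: "fps_nth f k \<noteq> fps_nth g k"
  define e where "e = nabs (fps_nth f k - fps_nth g k) * (1/2) ^ k / 2"
  have e: "e > 0" using neq by (simp add: e_def)
  have e2: "nabs (fps_nth f k - fps_nth g k) * (1/2) ^ k = 2 * e"
    unfolding e_def by simp
  obtain N1 where N1: "\<forall>n\<ge>N1. rbd (1/2) e (F n - f)"
    using Hconv_rbd[OF assms(1), of "1/2" e] e by auto
  obtain N2 where N2: "\<forall>n\<ge>N2. rbd (1/2) e (F n - g)"
    using Hconv_rbd[OF assms(2), of "1/2" e] e by auto
  define n where "n = max N1 N2"
  have "rbd (1/2) e (F n - g)" "rbd (1/2) e (F n - f)"
    using N1 N2 by (simp_all add: n_def)
  hence "rbd (1/2) e ((F n - g) - (F n - f))"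
    by (rule rbd_diff) simp
  hence "rbd (1/2) e (f - g)" by simp
  from rbdD[OF this, of k] e2 e show False
    by simp
qed

end

locale complete_nonarch_field = nonarch_field nabs for nabs :: "'k::field \<Rightarrow> real" +
  assumes complete: "\<forall>e>0. \<exists>N. \<forall>m\<ge>N. \<forall>n\<ge>N. nabs (X m - X n) < e \<Longrightarrow> \<exists>L. vtends nabs X L"
begin

text \<open>The ultrametric inequality reduces the Cauchy property to consecutive differences.
  Coefficientwise limits exist by completeness of the field, and the Cauchy bound, being uniform in
  the coefficient, survives in the limit.\<close>

lemma Hcomplete:
  assumes H: "\<And>n. inH nabs (F n)"
    and step: "\<And>r e. 0 \<le> r \<Longrightarrow> r < 1 \<Longrightarrow> 0 < e \<Longrightarrow> \<exists>N. \<forall>n\<ge>N. rbd r e (F (Suc n) - F n)"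
  shows "\<exists>f. Hconv nabs F f"
proof -
  have cauchy: "\<exists>N. \<forall>m\<ge>N. \<forall>n\<ge>N. rbd r e (F m - F n)" if r: "0 \<le> r" "r < 1" "0 < e" for r e
  proof -
    obtain N where N: "\<And>n. n \<ge> N \<Longrightarrow> rbd r e (F (Suc n) - F n)"
      using step[OF r] by blast
    have base: "rbd r e (F n - F N)" if "n \<ge> N" for n
      using that
    proof (induction n rule: dec_induct)
      case (step n)
      have "rbd r e ((F (Suc n) - F n) + (F n - F N))"
        using N step r by (intro rbd_add) auto
      thus ?case by simp
    qed (use r in simp)
    have "rbd r e (F m - F n)" if "m \<ge> N" "n \<ge> N" for m n
      using rbd_diff[OF base[OF that(1)] base[OF that(2)] r(1)] by simp
    thus ?thesis by blast
  qed
  have "\<exists>L. vtends nabs (\<lambda>n. fps_nth (F n) k) L" for k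
  proof (rule complete, intro allI impI)
    fix e :: real assume e: "e > 0"
    \<comment> \<open>Any radius strictly between 0 and 1 would serve; \<open>(1/2) ^ k\<close>
      cancels the weight of the \<open>k\<close>-th coefficient and the last \<open>2\<close> makes
      the inequality strict.\<close>
    have "e * (1/2) ^ k / 2 > 0" using e by simp
    then obtain N where N: "\<And>m n. m \<ge> N \<Longrightarrow> n \<ge> N \<Longrightarrow> rbd (1/2) (e * (1/2) ^ k / 2) (F m - F n)"
      using cauchy[of "1/2"] by force
    have "nabs (fps_nth (F m) k - fps_nth (F n) k) < e" if "m \<ge> N" "n \<ge> N" for m n
      using rbdD[OF N[OF that], of k] e by simp
    thus "\<exists>N. \<forall>m\<ge>N. \<forall>n\<ge>N. nabs (fps_nth (F m) k - fps_nth (F n) k) < e" by blast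
  qed
  then obtain l where l: "\<And>k. vtends nabs (\<lambda>n. fps_nth (F n) k) (l k)" by metis
  define f where "f = Abs_fps l"
  have lim: "\<exists>N. \<forall>n\<ge>N. rbd r e (F n - f)" if r: "0 \<le> r" "r < 1" "0 < e" for r e
  proof -
    obtain N where N: "\<And>m n. m \<ge> N \<Longrightarrow> n \<ge> N \<Longrightarrow> rbd r e (F m - F n)"
      using cauchy[OF r] by blast
    have "rbd r e (F n - f)" if n: "n \<ge> N" for n
      unfolding rbd_def
    proof
      fix k
      obtain M where M: "\<And>m. m \<ge> M \<Longrightarrow> nabs (fps_nth (F m) k - l k) < e"
        using l[of k] r unfolding vtends_def by blast
      \<comment> \<open>This index depends on \<open>k\<close>, but the threshold \<open>N\<close>
        for \<open>n\<close> does not.\<close>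
      define m where "m = max M N"
      have "r ^ k \<le> 1" "0 \<le> r ^ k" using r by (auto simp: power_le_one)
      hence "nabs (fps_nth (F m) k - l k) * r ^ k \<le> e * 1"
        using M[of m] r by (intro mult_mono) (auto simp: m_def)
      moreover have "nabs (fps_nth (F n) k - fps_nth (F m) k) * r ^ k \<le> e"
        using rbdD[OF N[of n m], of k] n by (simp add: m_def)
      moreover have "nabs (fps_nth (F n) k - l k) \<le>
          max (nabs (fps_nth (F n) k - fps_nth (F m) k)) (nabs (fps_nth (F m) k - l k))"
        using nabs_add[of "fps_nth (F n) k - fps_nth (F m) k" "fps_nth (F m) k - l k"] by simp
      ultimately have "nabs (fps_nth (F n) k - l k) * r ^ k \<le> e"
        using mult_right_mono[OF _ \<open>0 \<le> r ^ k\<close>] unfolding le_max_iff_disj mult_1_right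
        by (meson order_trans)
      thus "nabs (fps_nth (F n - f) k) * r ^ k \<le> e"
        by (simp add: f_def)
    qed
    thus ?thesis by blast
  qed
  have "inH nabs f"
    unfolding inH_iff
  proof (intro allI impI)
    fix r :: real assume r: "0 \<le> r \<and> r < 1"
    obtain N where "rbd r 1 (F N - f)" using lim[of r 1] r by auto
    moreover obtain B where "rbd r B (F N)" using H r unfolding inH_iff by blast
    ultimately have "rbd r (max 1 B) (F N - f)" "rbd r (max 1 B) (F N)"
      by (meson rbd_mono max.cobounded1 max.cobounded2)+
    from rbd_diff[OF this(2,1)] r show "\<exists>B. rbd r B f" by auto
  qed
  thus ?thesis unfolding Hconv_iff using H lim by blast
qed

text \<open>The recursion reads \<open>F (Suc n) = (1 + E n) F n\<close> with \<open>E n\<close>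
  tending to 0. Once \<open>E n\<close> is bounded by 1, the norms of \<open>F n\<close> stop
  growing by the ultrametric inequality, and then the increments tend to 0. It serves for columns of
  matrices and, with a one-point index set, for products of power series.\<close>

lemma Hconv_linear_recursion:
  fixes F :: "nat \<Rightarrow> 'i \<Rightarrow> 'k fps"
  assumes I: "finite I" and H: "\<And>n i. i \<in> I \<Longrightarrow> inH nabs (F n i)"
    and rec: "\<And>n i. n \<ge> M \<Longrightarrow> i \<in> I \<Longrightarrow> F (Suc n) i = F n i + (\<Sum>k\<in>I. E n i k * F n k)"
    and E: "\<And>r e. 0 \<le> r \<Longrightarrow> r < 1 \<Longrightarrow> 0 < e \<Longrightarrow> \<exists>N. \<forall>n\<ge>N. \<forall>i\<in>I. \<forall>k\<in>I. rbd r e (E n i k)"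
    and i: "i \<in> I"
  shows "\<exists>f. Hconv nabs (\<lambda>n. F n i) f"
proof (rule Hcomplete)
  fix r e :: real assume r: "0 \<le> r" "r < 1" "0 < e"
  obtain N1 where N1: "\<And>n i k. n \<ge> N1 \<Longrightarrow> i \<in> I \<Longrightarrow> k \<in> I \<Longrightarrow> rbd r 1 (E n i k)"
    using E[of r 1] r by auto
  define L where "L = max N1 M"
  have "\<forall>i\<in>I. \<exists>B. rbd r B (F L i)" using H r unfolding inH_iff by blast
  then obtain b where b: "\<And>i. i \<in> I \<Longrightarrow> rbd r (b i) (F L i)" by metis
  \<comment> \<open>The summand 1 makes \<open>B\<close> positive, so that \<open>e / B\<close>
    below is a legitimate precision.\<close>
  define B where "B = 1 + (\<Sum>i\<in>I. b i)"
  have b0: "0 \<le> b i" if "i \<in> I" for i using b[OF that] rbd_nonneg by blast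
  hence B1: "B \<ge> 1" unfolding B_def by (simp add: sum_nonneg)
  have bd: "\<forall>i\<in>I. rbd r B (F n i)" if "n \<ge> L" for n
    using that
  proof (induction n rule: dec_induct)
    case base
    have "b i \<le> B" if "i \<in> I" for i
      using member_le_sum[OF that, of b] b0 I unfolding B_def by fastforce
    thus ?case using b rbd_mono by blast
  next
    case (step n)
    have "rbd r B (E n i k * F n k)" if "i \<in> I" "k \<in> I" for i k
      using rbd_mult[of r 1 "E n i k" B "F n k"] N1 step that r by (simp add: L_def)
    thus ?case
      using rec step r B1 by (auto simp: L_def intro!: rbd_add rbd_sum)
  qed
  obtain N2 where N2: "\<And>n i k. n \<ge> N2 \<Longrightarrow> i \<in> I \<Longrightarrow> k \<in> I \<Longrightarrow> rbd r (e / B) (E n i k)"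
    using E[of r "e / B"] r B1 by auto
  have "rbd r e (F (Suc n) i - F n i)" if n: "n \<ge> max N2 L" for n
  proof -
    have "rbd r e (E n i k * F n k)" if "k \<in> I" for k
      using rbd_mult[of r "e / B" "E n i k" B "F n k"] N2 bd i that r n B1 by auto
    thus ?thesis using rec[of n i] i n r by (auto simp: L_def intro!: rbd_sum)
  qed
  thus "\<exists>N. \<forall>n\<ge>N. rbd r e (F (Suc n) i - F n i)" by blast
qed (use H i in auto)

end

section \<open>Cyclotomic estimates\<close>

context nonarch_field
begin

lemma nabs_eq_1_of_near_1: "nabs (c - 1) < 1 \<Longrightarrow> nabs c = 1"
  using nabs_eq_of_diff_less[of c 1] by simp

lemma nabs_of_nat_le_1: "nabs (of_nat n) \<le> 1"
  using nabs_sum_le[of "{..<n}" "\<lambda>_. 1" 1] by simp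

lemma nabs_power_minus_1:
  assumes "nabs c = 1"
  shows "nabs (c ^ n - 1) \<le> nabs (c - 1)"
proof -
  have "nabs (\<Sum>i<n. c ^ i) \<le> 1"
    by (rule nabs_sum_le) (simp_all add: nabs_power assms)
  thus ?thesis
    using mult_left_mono[of "nabs (\<Sum>i<n. c ^ i)" 1 "nabs (c - 1)"]
    by (simp add: power_diff_1_eq nabs_mult)
qed

lemma nabs_power_int_minus_1:
  assumes "nabs c = 1"
  shows "nabs (c powi n - 1) \<le> nabs (c - 1)"
proof (cases "n \<ge> 0")
  case True
  thus ?thesis using nabs_power_minus_1[OF assms] by (simp add: power_int_def)
next
  case False
  have "c \<noteq> 0" using assms by auto
  hence "inverse c - 1 = (1 - c) / c" by (simp add: field_simps)
  hence "nabs (inverse c - 1) = nabs (c - 1)"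
    using assms by (simp add: nabs_divide nabs_diff_commute[of 1 c])
  moreover have "nabs (inverse c) = 1" using assms by (simp add: nabs_inverse)
  ultimately show ?thesis
    using nabs_power_minus_1[of "inverse c" "nat (- n)"] False by (simp add: power_int_def)
qed

end

locale padic_twist = nonarch_field nabs for nabs :: "'k::field_char_0 \<Rightarrow> real" +
  fixes p :: nat and u :: 'k
  assumes p: "prime p" "odd p" and Qp: "is_Qp p nabs" and u: "top_generator p nabs u"
begin

lemma p_gt_1: "1 < p"
  using p(1) prime_gt_1_nat by blast

sublocale complete_nonarch_field nabs
  using Qp by unfold_locales (auto simp: is_Qp_def)

lemma nabs_of_nat: "0 < n \<Longrightarrow> nabs (of_nat n) = 1 / real p ^ multiplicity (int p) (int n)"
proof -
  assume "0 < n"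
  have "nabs (of_nat n) = padic_abs_rat p (of_nat n)"
    using Qp unfolding is_Qp_def by (metis of_rat_of_nat_eq)
  also have "padic_val_rat p (of_nat n) = int (multiplicity (int p) (int n))"
    using quotient_of_rat_of_int[of "int n"] by (simp add: padic_val_rat_def)
  hence "padic_abs_rat p (of_nat n) = 1 / real p ^ multiplicity (int p) (int n)"
    using \<open>0 < n\<close> p_gt_1 by (simp add: padic_abs_rat_def powr_minus powr_realpow divide_inverse)
  finally show ?thesis .
qed

lemma nabs_p: "nabs (of_nat p) = 1 / p"
  using nabs_of_nat[of p] p p_gt_1 by simp

text \<open>The power of \<open>p\<close> dividing \<open>n\<close> is at most \<open>n\<close>.
  This limits the damage done by the denominator k in the binomial coefficients of
  (1+x)^(p^m).\<close>

lemma nabs_of_nat_ge: "0 < n \<Longrightarrow> 1 / real n \<le> nabs (of_nat n)"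
proof -
  assume n: "0 < n"
  have "int p ^ multiplicity (int p) (int n) dvd int n" by (rule multiplicity_dvd)
  hence "p ^ multiplicity (int p) (int n) \<le> n"
    using n by (metis dvd_imp_le of_nat_dvd_iff of_nat_power)
  hence "real p ^ multiplicity (int p) (int n) \<le> real n"
    by (metis of_nat_le_iff of_nat_power)
  thus ?thesis
    using n p_gt_1 by (simp add: nabs_of_nat frac_le)
qed

text \<open>Expanding \<open>c = 1 + z\<close>, the sum is \<open>p + z p (p - 1) / 2 + O(z\<^sup>2)\<close>; oddness of \<open>p\<close> makes
  the middle term negligible.\<close>

lemma nabs_geometric_sum:
  assumes c: "nabs (c - 1) \<le> 1 / p"
  shows "nabs (\<Sum>i<p. c ^ i) = 1 / p"
proof -
  define z where "z = c - 1"
  have c1: "nabs c = 1"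
    using c p_gt_1 by (intro nabs_eq_1_of_near_1) (simp add: order_le_less_trans)
  have z2: "nabs z * nabs z \<le> (1 / p) ^ 2"
    unfolding z_def power2_eq_square using c by (intro mult_mono) auto
  have quad: "nabs (c ^ i - 1 - of_nat i * z) \<le> (1 / p) ^ 2" for i
  proof -
    have "c ^ i - 1 - of_nat i * z = z * (\<Sum>k<i. c ^ k - 1)"
      unfolding sum_subtractf z_def by (simp add: right_diff_distrib power_diff_1_eq[of c i] mult.commute)
    moreover have "nabs (\<Sum>k<i. c ^ k - 1) \<le> nabs z"
      using nabs_power_minus_1[OF c1] by (intro nabs_sum_le) (simp_all add: z_def)
    ultimately show ?thesis
      using mult_left_mono[of "nabs (\<Sum>k<i. c ^ k - 1)" "nabs z" "nabs z"] z2
      by (simp add: nabs_mult)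
  qed
  obtain h where h: "p = 2 * h + 1" using p(2) by (elim oddE)
  have "(\<Sum>i<p. i) = p * h"
    unfolding h by (induction h) (simp_all add: algebra_simps)
  hence lin: "(\<Sum>i<p. of_nat i * z) = of_nat p * of_nat h * z"
    by (simp flip: sum_distrib_right of_nat_sum)
  have "nabs (of_nat p * of_nat h * z) \<le> (1 / p * 1) * (1 / p)"
    unfolding nabs_mult using c nabs_of_nat_le_1 nabs_p
    by (intro mult_mono) (auto simp: z_def)
  moreover have "nabs (\<Sum>i<p. c ^ i - 1 - of_nat i * z) \<le> (1 / p) ^ 2"
    using quad by (intro nabs_sum_le) auto
  moreover have "(\<Sum>i<p. c ^ i) - of_nat p = (\<Sum>i<p. c ^ i - 1 - of_nat i * z) + of_nat p * of_nat h * z"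
    unfolding lin[symmetric] by (simp add: sum_subtractf)
  ultimately have "nabs ((\<Sum>i<p. c ^ i) - of_nat p) \<le> (1 / p) ^ 2"
    using nabs_add[of "\<Sum>i<p. c ^ i - 1 - of_nat i * z" "of_nat p * of_nat h * z"]
    by (simp add: power2_eq_square)
  also have "\<dots> < nabs (of_nat p)"
    unfolding nabs_p using p_gt_1 by (simp add: power2_eq_square divide_less_eq)
  finally show ?thesis
    using nabs_eq_of_diff_less nabs_p by metis
qed

text \<open>Each \<open>p\<close>-th power multiplies the difference from 1 by a geometric sum of
  absolute value \<open>1 / p\<close>.\<close>

lemma nabs_pow_pow_minus_1:
  assumes c: "nabs (c - 1) \<le> 1 / p"
  shows "nabs (c ^ (p ^ m) - 1) \<le> (1 / p) ^ Suc m"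
proof (induction m)
  case (Suc m)
  let ?c = "c ^ (p ^ m)"
  have "(1 / real p) ^ Suc m \<le> (1 / real p) ^ 1"
    using p_gt_1 by (intro power_decreasing) auto
  hence "nabs (?c - 1) \<le> 1 / p" using Suc unfolding power_one_right by (rule order_trans[rotated])
  hence "nabs (?c ^ p - 1) = nabs (?c - 1) / p"
    unfolding power_diff_1_eq[of ?c p] nabs_mult by (simp add: nabs_geometric_sum)
  moreover have "?c ^ p = c ^ (p ^ Suc m)" by (simp add: power_mult[symmetric] mult.commute)
  moreover have "nabs (?c - 1) / p \<le> (1 / p) ^ Suc m / p"
    by (rule divide_right_mono[OF Suc]) simp
  ultimately show ?case by simp
qed (use c in simp)

lemma u_near_1: "nabs (u - 1) \<le> 1 / p"
  using u by (simp add: top_generator_def)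

lemma one_div_p_lt_1: "1 / real p < 1"
  using p_gt_1 by simp

lemma nabs_u: "nabs u = 1"
  using u_near_1 one_div_p_lt_1 by (intro nabs_eq_1_of_near_1) linarith

lemma u_nonzero: "u \<noteq> 0"
  using nabs_u by auto

text \<open>If \<open>u\<close> were a root of unity, its finitely many powers could not be dense in the infinite
  set \<open>1 + p \<int>\<^sub>p\<close>.\<close>

lemma u_not_root_of_unity:
  assumes "0 < n"
  shows "u ^ n \<noteq> 1"
proof
  assume un: "u ^ n = 1"
  define S where "S = (\<lambda>k. u ^ k) ` {..<n}"
  have powi: "u powi m \<in> S" for m
  proof -
    have "u powi m = u powi (int n * (m div int n) + m mod int n)" by simp
    also have "\<dots> = (u powi int n) powi (m div int n) * u powi (m mod int n)"
      unfolding power_int_mult[symmetric] using u_nonzero by (intro power_int_add) simp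
    also have "u powi int n = 1" using un by simp
    also have "u powi (m mod int n) = u ^ nat (m mod int n)"
      using assms by (simp add: power_int_def)
    finally have "u powi m = u ^ nat (m mod int n)" by simp
    moreover have "nat (m mod int n) < n" using assms by (simp add: nat_less_iff)
    ultimately show ?thesis by (auto simp: S_def)
  qed
  have near: "y \<in> S" if y: "nabs (y - 1) \<le> 1 / p" for y
  proof (rule ccontr)
    assume "y \<notin> S"
    define e where "e = Min ((\<lambda>s. nabs (s - y)) ` S)"
    have fin: "finite S" "S \<noteq> {}" using assms by (auto simp: S_def)
    have "e > 0" unfolding e_def using fin \<open>y \<notin> S\<close> by (subst Min_gr_iff) auto
    then obtain m where "nabs (u powi m - y) < e"
      using u y unfolding top_generator_def by blast
    moreover have "e \<le> nabs (u powi m - y)"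
      unfolding e_def using fin powi by (intro Min_le) auto
    ultimately show False by simp
  qed
  have "1 + of_nat p * of_nat i \<in> S" for i
    using nabs_of_nat_le_1[of i] p_gt_1
    by (intro near) (simp add: nabs_mult nabs_p divide_right_mono)
  hence "range (\<lambda>i. 1 + of_nat p * of_nat i) \<subseteq> S" by blast
  moreover have "inj (\<lambda>i. 1 + of_nat p * of_nat i :: 'k)"
    using p_gt_1 by (auto intro!: injI)
  ultimately show False
    using range_inj_infinite finite_subset unfolding S_def by blast
qed

text \<open>The constant by which the twist multiplies (1+x)^(p^m), because \<open>twist u j\<close>
  replaces \<open>1 + x\<close> by \<open>u powi (- j)\<close> times \<open>1 + x\<close>.\<close>

definition w :: "int \<Rightarrow> nat \<Rightarrow> 'k" where
  "w j m = (u powi (- j)) ^ (p ^ m)"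

lemma w_eq_powi: "w j m = u powi (- j * int (p ^ m))"
  by (simp add: w_def power_int_power')

lemma w_nonzero [simp]: "w j m \<noteq> 0"
  using u_nonzero by (simp add: w_def)

lemma w_Suc: "w j (Suc m) = w j m ^ p"
  by (simp add: w_def power_mult[symmetric] mult.commute)

lemma w_divide: "w i m / w j m = w (i - j) m"
  using u_nonzero by (simp add: w_def power_divide[symmetric] flip: power_int_diff)

lemma w_near_1: "nabs (w j m - 1) \<le> (1 / p) ^ Suc m"
  unfolding w_def using nabs_power_int_minus_1[OF nabs_u] u_near_1
  by (intro nabs_pow_pow_minus_1) (meson order_trans)

lemma w_near_1': "nabs (w j m - 1) \<le> 1 / p"
  using w_near_1[of j m] power_decreasing[of 1 "Suc m" "1 / real p"] p_gt_1 by simp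

lemma nabs_w: "nabs (w j m) = 1"
  using w_near_1'[of j m] one_div_p_lt_1 by (intro nabs_eq_1_of_near_1) linarith

text \<open>An equality would make a nonzero power of \<open>u\<close> equal to 1 if
  \<open>i\<close> and \<open>j\<close> differed. Distinctness of these constants is what makes
  different twists of \<open>omega p m\<close> comaximal.\<close>

lemma w_inj: "w i m = w j m \<longleftrightarrow> i = j"
proof
  assume "w i m = w j m"
  have aux: "x = 0" if "u powi x = 1" for x
  proof (rule ccontr)
    assume "x \<noteq> 0"
    have "u ^ nat \<bar>x\<bar> = 1"
      using that by (cases "x \<ge> 0") (auto simp: power_int_def inverse_eq_1_iff power_inverse)
    thus False using u_not_root_of_unity[of "nat \<bar>x\<bar>"] \<open>x \<noteq> 0\<close> by simp
  qed
  have "w (i - j) m = 1" using \<open>w i m = w j m\<close> by (simp flip: w_divide)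
  hence "- (i - j) * int (p ^ m) = 0" using aux unfolding w_eq_powi by blast
  thus "i = j" using p_gt_1 by simp
qed simp

end

section \<open>The interpolation polynomials\<close>

context nonarch_field
begin

text \<open>In long division each step subtracts \<open>t * b\<close>, where the coefficient of
  \<open>t\<close> is the quotient of the leading coefficients; as \<open>lead_coeff b\<close> has
  absolute value 1, this is bounded by \<open>B\<close>, and so are all later remainders.\<close>

lemma poly_division_bound:
  assumes b: "rbd 1 1 (fps_of_poly b)" "nabs (lead_coeff b) = 1" and f: "rbd 1 B (fps_of_poly f)"
  shows "\<exists>q r. f = q * b + r \<and> (r = 0 \<or> degree r < degree b)
    \<and> rbd 1 B (fps_of_poly q) \<and> rbd 1 B (fps_of_poly r)"
proof -
  have B: "0 \<le> B" using f rbd_nonneg by blast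
  have b0: "lead_coeff b \<noteq> 0" using b(2) by force
  have *: "f = 0 \<or> degree f < n \<Longrightarrow> rbd 1 B (fps_of_poly f) \<Longrightarrow>
    \<exists>q r. f = q * b + r \<and> (r = 0 \<or> degree r < degree b)
      \<and> rbd 1 B (fps_of_poly q) \<and> rbd 1 B (fps_of_poly r)" for n f
  proof (induction n arbitrary: f)
    case 0
    thus ?case using B by (intro exI[of _ 0]) simp
  next
    case (Suc n)
    show ?case
    proof (cases "f = 0 \<or> degree f < degree b \<or> degree f < n")
      case True
      thus ?thesis
      proof (elim disjE)
        assume "degree f < n"
        thus ?thesis using Suc by blast
      qed (use B Suc.prems in \<open>auto intro: exI[of _ 0]\<close>)
    next
      case False
      with Suc.prems have deg: "degree f = n" "degree b \<le> n" "f \<noteq> 0" by auto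
      define t where "t = monom (lead_coeff f / lead_coeff b) (n - degree b)"
      define g where "g = f - t * b"
      have t: "rbd 1 B (fps_of_poly t)"
        using rbdD[OF Suc.prems(2), of n] deg b(2) B
        by (auto simp: rbd_def t_def nabs_divide)
      hence "rbd 1 (B * 1) (fps_of_poly (t * b))"
        unfolding fps_of_poly_mult using b by (intro rbd_mult) auto
      hence g: "rbd 1 B (fps_of_poly g)"
        unfolding g_def fps_of_poly_diff using Suc.prems by (intro rbd_diff) auto
      have "degree (t * b) \<le> n"
        using degree_mult_le[of t b] degree_monom_le[of "lead_coeff f / lead_coeff b" "n - degree b"] deg
        unfolding t_def by linarith
      hence "degree g \<le> n" unfolding g_def using deg by (intro degree_diff_le) auto
      moreover have "coeff g n = 0"
        using deg b0 by (simp add: g_def t_def coeff_monom_mult)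
      ultimately have "g = 0 \<or> degree g < n"
        by (metis leading_coeff_0_iff le_neq_implies_less)
      then obtain q r where qr: "g = q * b + r" "r = 0 \<or> degree r < degree b"
        "rbd 1 B (fps_of_poly q)" "rbd 1 B (fps_of_poly r)"
        using Suc.IH g by blast
      have "f = (q + t) * b + r" using qr(1) by (simp add: g_def algebra_simps)
      moreover have "rbd 1 B (fps_of_poly (q + t))"
        unfolding fps_of_poly_add using qr t by (intro rbd_add) auto
      ultimately show ?thesis using qr by blast
    qed
  qed
  show ?thesis using *[of f "Suc (degree f)"] f by simp
qed

lemma poly_exact_division_bound:
  assumes "rbd 1 1 (fps_of_poly b)" "nabs (lead_coeff b) = 1" "rbd 1 B (fps_of_poly f)" "b dvd f"
  shows "\<exists>q. f = q * b \<and> rbd 1 B (fps_of_poly q)"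
proof -
  obtain q r where qr: "f = q * b + r" "r = 0 \<or> degree r < degree b" "rbd 1 B (fps_of_poly q)"
    using poly_division_bound[OF assms(1-3)] by blast
  have "b dvd r" using assms(4) qr(1) by (metis dvd_add_right_iff dvd_triv_right)
  hence "r = 0" using qr(2) by (metis dvd_imp_degree_le not_le)
  thus ?thesis using qr by auto
qed

end

section \<open>Congruences and comaximality\<close>

lemma pCons_0_sum: "(\<Sum>i\<in>A. [:f i:]) = [:\<Sum>i\<in>A. f i:]"
  by (induction A rule: infinite_finite_induct) simp_all

lemma dvd_prod_diff_const_prod:
  fixes b :: "'a::field poly"
  assumes "\<And>i. i \<in> A \<Longrightarrow> b dvd f i - [:c i:]"
  shows "b dvd (\<Prod>i\<in>A. f i) - [:\<Prod>i\<in>A. c i:]"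
  using assms
proof (induction A rule: infinite_finite_induct)
  case (insert a A)
  have "(\<Prod>i\<in>insert a A. f i) - [:\<Prod>i\<in>insert a A. c i:]
      = f a * ((\<Prod>i\<in>A. f i) - [:\<Prod>i\<in>A. c i:]) + (f a - [:c a:]) * [:\<Prod>i\<in>A. c i:]"
    using insert.hyps by (simp add: algebra_simps)
  moreover have "b dvd f a - [:c a:]" "b dvd (\<Prod>i\<in>A. f i) - [:\<Prod>i\<in>A. c i:]"
    using insert by auto
  ultimately show ?case by (metis dvd_add dvd_mult dvd_mult2)
qed (simp_all add: one_pCons)

text \<open>An explicit identity rather than a gcd condition: it is what the computations with
  twisted polynomials supply, and it passes to products and divisors by plain algebra.\<close>

definition bezout :: "'a::comm_ring_1 \<Rightarrow> 'a \<Rightarrow> bool" where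
  "bezout a b \<longleftrightarrow> (\<exists>s t. s * a + t * b = 1)"

lemma bezout_commute: "bezout a b \<longleftrightarrow> bezout b a"
  unfolding bezout_def by (metis add.commute)

lemma bezout_dvd_right: "bezout a b \<Longrightarrow> c dvd b \<Longrightarrow> bezout a c"
  unfolding bezout_def dvd_def by (metis mult.assoc mult.commute)

lemma bezout_mult_right: "bezout a b \<Longrightarrow> bezout a c \<Longrightarrow> bezout a (b * c)"
proof -
  assume "bezout a b" "bezout a c"
  then obtain s t s' t' where *: "s * a + t * b = 1" "s' * a + t' * c = 1"
    unfolding bezout_def by blast
  have "(s * s' * a + s * t' * c + t * b * s') * a + (t * t') * (b * c)
      = (s * a + t * b) * (s' * a + t' * c)"
    by (simp add: algebra_simps)
  thus ?thesis unfolding bezout_def using * by (metis mult_1)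
qed

lemma bezout_prod_right: "(\<And>i. i \<in> A \<Longrightarrow> bezout a (f i)) \<Longrightarrow> bezout a (\<Prod>i\<in>A. f i)"
  by (induction A rule: infinite_finite_induct)
    (auto intro: bezout_mult_right simp: bezout_def[of a 1] intro: exI[of _ 0])

lemma bezout_mult_dvd: "bezout a b \<Longrightarrow> a dvd c \<Longrightarrow> b dvd c \<Longrightarrow> a * b dvd c"
proof -
  assume "bezout a b" "a dvd c" "b dvd c"
  then obtain s t x y where *: "s * a + t * b = 1" "c = a * x" "c = b * y"
    unfolding bezout_def dvd_def by blast
  have "a * b * (s * y + t * x) = s * a * (b * y) + t * b * (a * x)"
    by (simp add: algebra_simps)
  also have "\<dots> = (s * a + t * b) * c"
    unfolding *(2,3)[symmetric] by (simp add: distrib_right)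
  finally show ?thesis using *(1) by (metis dvd_triv_left mult_1)
qed

lemma bezout_prod_dvd:
  assumes "\<And>i j. i \<in> A \<Longrightarrow> j \<in> A \<Longrightarrow> i \<noteq> j \<Longrightarrow> bezout (f i) (f j)" "\<And>i. i \<in> A \<Longrightarrow> f i dvd c"
  shows "(\<Prod>i\<in>A. f i) dvd c"
  using assms
proof (induction A rule: infinite_finite_induct)
  case (insert a A)
  have "bezout (f a) (\<Prod>i\<in>A. f i)"
    using insert by (intro bezout_prod_right) auto
  thus ?case using insert by (simp add: bezout_mult_dvd)
qed simp_all

lemma pcompose_power: "pcompose (f ^ n) g = pcompose f g ^ n"
  by (induction n) (simp_all add: pcompose_mult pcompose_1)

section \<open>Twists of the cyclotomic factors and the interpolation problem\<close>

context padic_twist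
begin

text \<open>With y = (1+x)^(p^m), \<open>Z j m\<close> is \<open>w j m\<close> times y,
  \<open>om j m\<close> is linear in y and \<open>G j m\<close> is a polynomial in y. The
  congruences at a fixed level are computed in this single variable.\<close>

definition Z :: "int \<Rightarrow> nat \<Rightarrow> 'k poly" where
  "Z j m = Polynomial.smult (w j m) ([:1, 1:] ^ (p ^ m))"

definition om :: "int \<Rightarrow> nat \<Rightarrow> 'k poly" where
  "om j m = Z j m - 1"

text \<open>Mind the shift of level: this is the twist of \<open>xi p (Suc m)\<close>, the quotient
  of \<open>om j (Suc m)\<close> by \<open>om j m\<close>.\<close>

definition G :: "int \<Rightarrow> nat \<Rightarrow> 'k poly" where
  "G j m = (\<Sum>i<p. Z j m ^ i)"

lemma twist_linear_power: "pcompose ([:1, 1:] ^ (p ^ m)) [:u powi (-j) - 1, u powi (-j):] = Z j m"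
proof -
  have "pcompose [:1, 1:] [:u powi (-j) - 1, u powi (-j):] = Polynomial.smult (u powi (-j)) [:1, 1:]"
    by (simp add: pcompose_pCons)
  thus ?thesis unfolding pcompose_power Z_def w_def by (simp only: smult_power)
qed

lemma twist_omega: "twist u j (omega p m) = om j m"
  unfolding twist_def omega_def om_def by (simp add: pcompose_diff pcompose_1 twist_linear_power)

lemma omegaS_eq: "omegaS p u m S = (\<Prod>j\<in>S. om j m)"
  by (simp add: omegaS_def twist_omega)

lemma Z_Suc: "Z j (Suc m) = Z j m ^ p"
  by (simp add: Z_def w_Suc smult_power power_mult[symmetric] mult.commute)

lemma om_Suc: "om j (Suc m) = om j m * G j m"
  unfolding om_def G_def Z_Suc by (rule power_diff_1_eq)

lemma degree_Z: "degree (Z j m) = p ^ m"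
  by (simp add: Z_def degree_linear_power)

lemma lead_coeff_Z: "lead_coeff (Z j m) = w j m"
  by (simp add: Z_def lead_coeff_power)

lemma degree_om: "degree (om j m) = p ^ m"
  using degree_add_eq_left[of "- 1" "Z j m"] p_gt_1 by (simp add: om_def degree_Z)

lemma lead_coeff_om: "lead_coeff (om j m) = w j m"
  using lead_coeff_Z[of j m] p_gt_1 unfolding degree_om degree_Z by (simp add: om_def)

lemma om_nonzero [simp]: "om j m \<noteq> 0"
  using lead_coeff_om[of j m] by (metis lead_coeff_Z leading_coeff_0_iff w_nonzero)

lemma G_nonzero [simp]: "G j m \<noteq> 0"
  using om_nonzero[of j "Suc m"] unfolding om_Suc by auto

lemma degree_G: "degree (G j m) = (p - 1) * p ^ m"
proof -
  have "p ^ Suc m = p ^ m + degree (G j m)"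
    by (metis degree_om om_Suc degree_mult_eq om_nonzero G_nonzero)
  thus ?thesis by (simp add: diff_mult_distrib)
qed

lemma nabs_lead_coeff_G: "nabs (lead_coeff (G j m)) = 1"
proof -
  have "w j (Suc m) = w j m * lead_coeff (G j m)"
    by (metis lead_coeff_om om_Suc lead_coeff_mult)
  thus ?thesis by (metis nabs_w nabs_mult mult_1)
qed

lemma twist_xi: "twist u j (xi p (Suc m)) = G j m"
proof -
  let ?X = "[:1, 1:] ^ (p ^ m) :: 'k poly"
  have "omega p (Suc m) = (omega p m :: 'k poly) * (\<Sum>i<p. ?X ^ i)"
    unfolding omega_def power_diff_1_eq[symmetric] by (simp add: power_mult[symmetric] mult.commute)
  \<comment> \<open>Composition sends 0 to 0, so nonvanishing follows from that of the twist; it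
    permits the cancellation in the \<open>div\<close> that defines \<open>xi\<close>.\<close>
  moreover have "omega p m \<noteq> (0 :: 'k poly)"
    using twist_omega[of j m] by (auto simp: twist_def)
  ultimately have "xi p (Suc m) = (\<Sum>i<p. ?X ^ i)"
    by (simp add: xi_def)
  thus ?thesis
    by (simp add: twist_def G_def pcompose_sum pcompose_power[of ?X] twist_linear_power)
qed

lemma rbd_linear_power: "rbd 1 1 (fps_of_poly ([:1, 1:] ^ n))"
proof -
  have "rbd 1 1 (fps_of_poly [:1, 1 :: 'k:])"
    by (simp add: rbd_def coeff_pCons split: nat.split)
  from rbd_power[OF this, of n] show ?thesis by (simp add: fps_of_poly_power)
qed

lemma rbd_Z: "rbd 1 1 (fps_of_poly (Z j m))"
proof -
  have "rbd 1 (nabs (w j m) * 1) (fps_const (w j m) * fps_of_poly ([:1, 1:] ^ (p ^ m)))"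
    by (intro rbd_mult rbd_linear_power) auto
  thus ?thesis by (simp add: Z_def fps_of_poly_smult nabs_w)
qed

lemma rbd_om: "rbd 1 1 (fps_of_poly (om j m))"
  unfolding om_def fps_of_poly_diff by (intro rbd_diff rbd_Z) auto

lemma rbd_G: "rbd 1 1 (fps_of_poly (G j m))"
  unfolding G_def fps_of_poly_sum fps_of_poly_power
  using rbd_power[OF rbd_Z] by (intro rbd_sum) auto

lemma rbd_prod_1: "(\<And>i. i \<in> A \<Longrightarrow> rbd 1 1 (fps_of_poly (f i))) \<Longrightarrow> rbd 1 1 (fps_of_poly (\<Prod>i\<in>A. f i))"
  using rbd_prod[of A 1 "\<lambda>_. 1" "\<lambda>i. fps_of_poly (f i)"] by (simp add: fps_of_poly_prod)

text \<open>Modulo \<open>om j m\<close> one has \<open>Z j m = 1\<close>, so y is the constant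
  \<open>1 / w j m\<close> and \<open>Z i m\<close> becomes \<open>w i m / w j m\<close>. For
  \<open>i = j\<close> the ratio is 1 and the residue is \<open>p\<close>.\<close>

lemma om_dvd_G_diff: "om j m dvd G i m - [:\<Sum>k<p. (w i m / w j m) ^ k:]"
proof -
  let ?a = "w i m / w j m"
  have "Z i m - [:?a:] = Polynomial.smult ?a (om j m)"
    by (simp add: om_def Z_def smult_diff_right one_pCons)
  hence "om j m dvd Z i m - [:?a:]" by (simp add: dvd_smult)
  moreover have "Z i m - [:?a:] dvd Z i m ^ k - [:?a:] ^ k" for k
    by (cases k) (simp_all only: diff_power_eq_sum dvd_triv_left power_0 diff_self dvd_0_right)
  ultimately have "om j m dvd Z i m ^ k - [:?a:] ^ k" for k
    using dvd_trans by blast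
  hence "om j m dvd (\<Sum>k<p. Z i m ^ k - [:?a:] ^ k)"
    by (intro dvd_sum)
  also have "(\<Sum>k<p. Z i m ^ k - [:?a:] ^ k) = G i m - [:\<Sum>k<p. ?a ^ k:]"
    unfolding G_def sum_subtractf poly_const_pow pCons_0_sum ..
  finally show ?thesis .
qed

text \<open>Both polynomials are linear in y with constant term -1 and different slopes, so
  eliminating y leaves a nonzero constant.\<close>

lemma bezout_om: "i \<noteq> j \<Longrightarrow> bezout (om i m) (om j m)"
proof -
  assume "i \<noteq> j"
  define c where "c = w i m - w j m"
  have "c \<noteq> 0" using \<open>i \<noteq> j\<close> w_inj by (simp add: c_def)
  \<comment> \<open>Here \<open>y\<close> and \<open>e\<close> stand for the coefficients of
    (1+x)^(p^m) and of 1 in a fixed degree.\<close>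
  have eq: "w j m / c * (w i m * y - e) + - (w i m / c) * (w j m * y - e) = e" for y e
    using \<open>c \<noteq> 0\<close> by (simp add: field_simps) (simp add: c_def algebra_simps)
  have "[:w j m / c:] * om i m + [:- (w i m / c):] * om j m = 1"
  proof (rule poly_eqI)
    fix n
    show "coeff ([:w j m / c:] * om i m + [:- (w i m / c):] * om j m) n = coeff 1 n"
      using eq[of "coeff ([:1, 1:] ^ (p ^ m)) n" "coeff 1 n"]
      unfolding om_def Z_def by (simp del: coeff_1)
  qed
  thus ?thesis unfolding bezout_def by blast
qed

text \<open>Modulo \<open>om j m\<close> the sum \<open>G j m\<close> is \<open>p\<close>, a unit in
  characteristic 0. Congruences modulo \<open>om j (Suc m)\<close> can thus be checked on its two
  factors.\<close>

lemma bezout_om_G: "bezout (om j m) (G j m)"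
proof -
  have "om j m dvd G j m - [:of_nat p:]"
    using om_dvd_G_diff[of j m j] by simp
  then obtain s where s: "G j m - [:of_nat p:] = om j m * s" by (elim dvdE)
  have "Polynomial.smult (1 / of_nat p) (G j m - om j m * s) = 1"
    using p_gt_1 unfolding s[symmetric] by (simp add: one_pCons)
  hence "Polynomial.smult (- 1 / of_nat p) s * om j m + [:1 / of_nat p:] * G j m = 1"
    by (simp add: smult_diff_right mult.commute)
  thus ?thesis unfolding bezout_def by blast
qed

text \<open>Write \<open>F = \<Prod>j\<in>J. om j m\<close> and \<open>G = \<Prod>i\<in>J'. G i m\<close>. Modulo \<open>om j m\<close>, \<open>G\<close> is a
  constant \<open>\<gamma> j\<close> of absolute value \<open>p ^ - card J'\<close>, so \<open>G - \<gamma> j = H j * om j m\<close> with \<open>H j\<close> integral, and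
  \<open>\<Prod>j\<in>J. - H j / \<gamma> j\<close> is an inverse of \<open>F\<close> modulo \<open>G\<close>.\<close>

lemma inverse_omegaS_mod_G:
  assumes "finite J" "finite J'"
  shows "\<exists>r q. omegaS p u m J * r = 1 + q * (\<Prod>i\<in>J'. G i m)
    \<and> (r = 0 \<or> degree r < degree (\<Prod>i\<in>J'. G i m))
    \<and> rbd 1 (real p ^ (card J' * card J)) (fps_of_poly r)"
proof -
  define GG where "GG = (\<Prod>i\<in>J'. G i m)"
  define \<gamma> where "\<gamma> j = (\<Prod>i\<in>J'. \<Sum>k<p. (w i m / w j m) ^ k)" for j
  have nabs_\<gamma>: "nabs (\<gamma> j) = (1 / p) ^ card J'" for j
  proof -
    have "nabs (\<Sum>k<p. (w i m / w j m) ^ k) = 1 / p" for i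
      unfolding w_divide by (rule nabs_geometric_sum[OF w_near_1'])
    thus ?thesis by (simp add: \<gamma>_def nabs_prod)
  qed
  have \<gamma>0: "\<gamma> j \<noteq> 0" for j
    using nabs_\<gamma>[of j] p_gt_1 by auto
  have GG: "rbd 1 1 (fps_of_poly GG)" "nabs (lead_coeff GG) = 1" "GG \<noteq> 0"
    unfolding GG_def using assms
    by (auto simp: rbd_G nabs_lead_coeff_G lead_coeff_prod nabs_prod intro!: rbd_prod_1)
  have "\<exists>H. GG - [:\<gamma> j:] = H * om j m \<and> rbd 1 1 (fps_of_poly H)" for j
  proof (rule poly_exact_division_bound[OF rbd_om])
    show "nabs (lead_coeff (om j m)) = 1" by (simp only: lead_coeff_om nabs_w)
    have "nabs (\<gamma> j) \<le> 1" using p_gt_1 by (simp add: nabs_\<gamma> power_le_one)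
    thus "rbd 1 1 (fps_of_poly (GG - [:\<gamma> j:]))"
      unfolding fps_of_poly_diff fps_of_poly_const using GG by (intro rbd_diff) auto
    show "om j m dvd GG - [:\<gamma> j:]"
      unfolding GG_def \<gamma>_def by (rule dvd_prod_diff_const_prod[OF om_dvd_G_diff])
  qed
  then obtain H where H: "\<And>j. GG - [:\<gamma> j:] = H j * om j m" "\<And>j. rbd 1 1 (fps_of_poly (H j))"
    by metis
  define Q where "Q = (\<Prod>j\<in>J. [:- 1 / \<gamma> j:] * H j)"
  \<comment> \<open>The only loss of integrality is the factor \<open>1 / \<gamma> j\<close>, one
    for each \<open>j\<close> in \<open>J\<close>: this is the origin of the exponent
    \<open>card J' * card J\<close>.\<close>
  have "rbd 1 (real p ^ card J' * 1) (fps_of_poly ([:- 1 / \<gamma> j:] * H j))" for j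
    unfolding fps_of_poly_mult fps_of_poly_const
    using H(2) by (intro rbd_mult) (auto simp: nabs_divide nabs_\<gamma> power_divide)
  hence "rbd 1 (\<Prod>j\<in>J. real p ^ card J') (fps_of_poly Q)"
    unfolding Q_def fps_of_poly_prod by (intro rbd_prod) auto
  hence Qbd: "rbd 1 (real p ^ (card J' * card J)) (fps_of_poly Q)"
    by (simp add: power_mult)
  have "omegaS p u m J * Q = (\<Prod>j\<in>J. 1 - [:1 / \<gamma> j:] * GG)"
    unfolding omegaS_eq Q_def prod.distrib[symmetric]
  proof (rule prod.cong)
    fix j
    have "om j m * ([:- 1 / \<gamma> j:] * H j) = [:- 1 / \<gamma> j:] * (GG - [:\<gamma> j:])"
      unfolding H(1) by (simp add: mult.commute)
    also have "\<dots> = [:1 / \<gamma> j * \<gamma> j:] - [:1 / \<gamma> j:] * GG"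
      by (simp add: smult_diff_right)
    finally show "om j m * ([:- 1 / \<gamma> j:] * H j) = 1 - [:1 / \<gamma> j:] * GG"
      using \<gamma>0 by (simp add: one_pCons)
  qed simp
  moreover have "GG dvd (\<Prod>j\<in>J. 1 - [:1 / \<gamma> j:] * GG) - [:\<Prod>j\<in>J. 1:]"
    by (rule dvd_prod_diff_const_prod) (simp add: one_pCons[symmetric] dvd_smult)
  ultimately have "GG dvd omegaS p u m J * Q - 1"
    by (simp add: one_pCons)
  then obtain s where s: "omegaS p u m J * Q - 1 = GG * s" by (elim dvdE)
  \<comment> \<open>Passing to the remainder provides the degree required for uniqueness, and
    division by \<open>GG\<close> keeps the bound.\<close>
  obtain q r where qr: "Q = q * GG + r" "r = 0 \<or> degree r < degree GG"
    "rbd 1 (real p ^ (card J' * card J)) (fps_of_poly r)"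
    using poly_division_bound[OF GG(1,2) Qbd] by blast
  have "omegaS p u m J * r = 1 + (s - omegaS p u m J * q) * GG"
    using s unfolding qr(1) by (simp add: algebra_simps)
  thus ?thesis using qr(2,3) unfolding GG_def by blast
qed

text \<open>Chinese remaindering: the moduli are pairwise comaximal and their product has exactly
  the degree that bounds \<open>P\<close> and \<open>Q\<close>, so it cannot divide a nonzero
  difference.\<close>

lemma xitilde_Suc_unique:
  fixes P Q :: "'k poly"
  assumes "finite J" "J' \<subseteq> J"
    and P: "\<forall>j\<in>J'. om j (Suc m) dvd P - f j" "\<forall>j\<in>J - J'. om j m dvd P - 1"
      "degree P < ((p - 1) * card J' + card J) * p ^ m"
    and Q: "\<forall>j\<in>J'. om j (Suc m) dvd Q - f j" "\<forall>j\<in>J - J'. om j m dvd Q - 1"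
      "degree Q < ((p - 1) * card J' + card J) * p ^ m"
  shows "P = Q"
proof (rule ccontr)
  assume "P \<noteq> Q"
  \<comment> \<open>The modulus attached to \<open>j\<close>. Levels \<open>m\<close> and
    \<open>Suc m\<close> are mixed, but every modulus divides the one of level \<open>Suc m\<close>,
    from which comaximality is inherited.\<close>
  define e where "e j = om j (if j \<in> J' then Suc m else m)" for j
  have e_dvd: "e j dvd om j (Suc m)" for j
    by (auto simp: e_def om_Suc)
  have dvd: "e j dvd P - Q" if "j \<in> J" for j
  proof (cases "j \<in> J'")
    case True
    hence "e j dvd (P - f j) - (Q - f j)"
      using P(1) Q(1) by (intro dvd_diff[of _ "P - f j"]) (simp_all add: e_def)
    thus ?thesis by simp
  next
    case False
    hence "e j dvd (P - 1) - (Q - 1)"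
      using P(2) Q(2) that by (intro dvd_diff[of _ "P - 1"]) (simp_all add: e_def)
    thus ?thesis by simp
  qed
  have bez: "bezout (e i) (e j)" if "i \<noteq> j" for i j
    using bezout_dvd_right[OF _ e_dvd] bezout_om[OF that, of "Suc m"] by (metis bezout_commute)
  have "(\<Prod>j\<in>J. e j) dvd P - Q"
    using bez dvd by (intro bezout_prod_dvd) auto
  hence "degree (\<Prod>j\<in>J. e j) \<le> degree (P - Q)"
    using \<open>P \<noteq> Q\<close> by (intro dvd_imp_degree_le) auto
  moreover have "degree (P - Q) < ((p - 1) * card J' + card J) * p ^ m"
    using degree_diff_le_max[of P Q] P(3) Q(3) by linarith
  moreover have "degree (\<Prod>j\<in>J. e j) = ((p - 1) * card J' + card J) * p ^ m"
  proof -
    have "degree (\<Prod>j\<in>J. e j) = (\<Sum>j\<in>J. (if j \<in> J' then (p - 1) * p ^ m else 0) + p ^ m)"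
      unfolding e_def using p_gt_1
      by (subst degree_prod_sum_eq) (auto simp: degree_om diff_mult_distrib intro!: sum.cong)
    also have "\<dots> = (\<Sum>j\<in>J. if j \<in> J' then (p - 1) * p ^ m else 0) + card J * p ^ m"
      by (simp add: sum.distrib)
    also have "(\<Sum>j\<in>J. if j \<in> J' then (p - 1) * p ^ m else 0) = card J' * ((p - 1) * p ^ m)"
      using assms(1,2) by (subst sum.If_cases) (auto simp: Int_absorb1)
    finally show ?thesis by (simp add: algebra_simps)
  qed
  ultimately show False by simp
qed

text \<open>The candidate \<open>1 - F r = - q G\<close> is 1 modulo every \<open>om j m\<close> and
  vanishes modulo \<open>G j m\<close> for \<open>j\<close> in \<open>J'\<close>. The prescribed
  value \<open>G j m / p\<close> has the same two residues, and together they determine it modulo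
  \<open>om j (Suc m)\<close>. Uniqueness identifies the candidate with \<open>xitilde\<close>, so
  that \<open>K = - r\<close>.\<close>

lemma xitilde_Suc:
  assumes J: "finite J" "J \<noteq> {}" "J' \<subseteq> J"
  shows "\<exists>K. xitilde p u (Suc m) J' J = 1 + omegaS p u m J * K
    \<and> rbd 1 (real p ^ (card J' * card J)) (fps_of_poly K)"
proof -
  let ?F = "omegaS p u m J" and ?G = "\<Prod>i\<in>J'. G i m"
  have J': "finite J'" using J finite_subset by blast
  obtain r q where rq: "?F * r = 1 + q * ?G" "r = 0 \<or> degree r < degree ?G"
    "rbd 1 (real p ^ (card J' * card J)) (fps_of_poly r)"
    using inverse_omegaS_mod_G[OF J(1) J', of m] by blast
  define P where "P = 1 - ?F * r"
  have F_dvd: "om j m dvd P - 1" if "j \<in> J" for j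
    using dvd_mult2[OF dvd_prodI[OF J(1) that, of "\<lambda>j. om j m"]] by (simp add: P_def omegaS_eq)
  have PG: "P = - q * ?G" by (simp add: P_def rq(1))
  have G_dvd: "G j m dvd P" if "j \<in> J'" for j
    unfolding PG using dvd_prodI[OF J' that, of "\<lambda>j. G j m"] by (rule dvd_mult)
  have cong1: "om j (Suc m) dvd P - Polynomial.smult (1 / of_nat p) (G j m)" if j: "j \<in> J'" for j
    unfolding om_Suc
  proof (rule bezout_mult_dvd[OF bezout_om_G])
    have "om j m dvd Polynomial.smult (1 / of_nat p) (G j m - [:of_nat p:])"
      using om_dvd_G_diff[of j m j] by (simp add: dvd_smult)
    also have "Polynomial.smult (1 / of_nat p) (G j m - [:of_nat p:]) = Polynomial.smult (1 / of_nat p) (G j m) - 1"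
      using p_gt_1 by (simp add: smult_diff_right one_pCons)
    finally have "om j m dvd (P - 1) - (Polynomial.smult (1 / of_nat p) (G j m) - 1)"
      using F_dvd j J(3) by (intro dvd_diff[of _ "P - 1"]) auto
    thus "om j m dvd P - Polynomial.smult (1 / of_nat p) (G j m)" by simp
    show "G j m dvd P - Polynomial.smult (1 / of_nat p) (G j m)"
      using G_dvd[OF j] by (intro dvd_diff) (simp_all add: dvd_smult)
  qed
  have degF: "degree ?F = card J * p ^ m"
    unfolding omegaS_eq by (subst degree_prod_sum_eq) (auto simp: degree_om)
  have degG: "degree ?G = card J' * ((p - 1) * p ^ m)"
    by (subst degree_prod_sum_eq) (auto simp: degree_G)
  have bound: "((p - 1) * card J' + card J) * p ^ m = degree ?F + degree ?G"
    unfolding degF degG by (simp add: algebra_simps)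
  have "0 < degree ?F" unfolding degF using J p_gt_1 by (simp add: card_gt_0_iff)
  have deg: "degree P < ((p - 1) * card J' + card J) * p ^ m"
  \<comment> \<open>For \<open>r = 0\<close>, as happens when \<open>J'\<close> is empty,
    \<open>P\<close> is 1 and the strict bound holds because the product over \<open>J\<close> has
    positive degree.\<close>
  proof (cases "r = 0")
    case True
    thus ?thesis unfolding bound using \<open>0 < degree ?F\<close> by (simp add: P_def)
  next
    case False
    hence "degree (?F * r) < degree ?F + degree ?G"
      using rq(2) degree_mult_le[of ?F r] by linarith
    thus ?thesis
      unfolding bound P_def using degree_diff_le_max[of 1 "?F * r"] \<open>0 < degree ?F\<close> by simp
  qed
  have "xitilde p u (Suc m) J' J = P"
    unfolding xitilde_def twist_omega twist_xi if_not_P[OF Suc_not_Zero] diff_Suc_1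
  proof (rule the_equality)
    fix Q
    assume "degree Q < ((p - 1) * card J' + card J) * p ^ m
      \<and> (\<forall>j\<in>J'. om j (Suc m) dvd Q - Polynomial.smult (1 / of_nat p) (G j m))
      \<and> (\<forall>j\<in>J - J'. om j m dvd Q - 1)"
    thus "Q = P"
      using deg cong1 F_dvd by (intro xitilde_Suc_unique[OF J(1,3)]) auto
  qed (use deg cong1 F_dvd in blast)
  thus ?thesis
    using rq(3) by (intro exI[of _ "- r"]) (simp add: P_def fps_of_poly_uminus)
qed

text \<open>For k > 0 the coefficient of x^k in (1+x)^(p^m) is p^m / k times a binomial coefficient,
  hence of size at most k / p^m; the factor k is absorbed because k r^k is bounded for
  \<open>r < 1\<close>. Twisting multiplies by a unit and adds the constant
  \<open>w j m - 1\<close>, which is smaller still.\<close>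

lemma om_bound:
  assumes r: "0 \<le> r" "r < 1"
  shows "\<exists>C. \<forall>m j. rbd r (C * (1 / p) ^ m) (fps_of_poly (om j m))"
proof -
  have "(\<lambda>n. real n * r ^ n) \<longlonglongrightarrow> 0"
    using powser_times_n_limit_0[of r] r by simp
  hence "Bseq (\<lambda>n. real n * r ^ n)"
    by (simp add: convergentI convergent_imp_Bseq)
  then obtain B where B: "\<And>n. norm (real n * r ^ n) \<le> B"
    unfolding Bseq_def by blast
  define C where "C = max 1 B"
  have C: "1 \<le> C" "real n * r ^ n \<le> C" for n
    using B[of n] by (auto simp: C_def)
  have "rbd r (C * (1 / p) ^ m) (fps_of_poly (om j m))" for m j
  proof -
    let ?X = "[:1, 1:] ^ (p ^ m) :: 'k poly"
    have X: "rbd r (C * (1 / p) ^ m) (fps_of_poly (?X - 1))"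
      unfolding rbd_def
    proof
      fix k
      show "nabs (fps_nth (fps_of_poly (?X - 1)) k) * r ^ k \<le> C * (1 / p) ^ m"
      proof (cases "k = 0 \<or> p ^ m < k")
        case True
        hence "coeff (?X - 1) k = 0"
          by (auto simp: coeff_eq_0 degree_linear_power coeff_linear_poly_power)
        thus ?thesis using C(1) by simp
      next
        case False
        hence k: "0 < k" "k \<le> p ^ m" by auto
        let ?b = "nabs (of_nat (p ^ m choose k))"
        have "k * (p ^ m choose k) = p ^ m * ((p ^ m - 1) choose (k - 1))"
          using k by (intro times_binomial_minus1_eq)
        hence "nabs (of_nat k) * ?b = nabs (of_nat (p ^ m)) * nabs (of_nat ((p ^ m - 1) choose (k - 1)))"
          by (metis nabs_mult of_nat_mult)
        also have "\<dots> \<le> nabs (of_nat (p ^ m)) * 1"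
          using nabs_of_nat_le_1 by (intro mult_left_mono) auto
        also have "\<dots> = (1 / p) ^ m" by (simp add: nabs_power nabs_p)
        finally have "nabs (of_nat k) * ?b \<le> (1 / p) ^ m" .
        moreover have "1 / real k * ?b \<le> nabs (of_nat k) * ?b"
          using nabs_of_nat_ge k by (intro mult_right_mono) auto
        ultimately have "1 / real k * ?b \<le> (1 / p) ^ m" by linarith
        hence "?b \<le> real k * (1 / p) ^ m" using k by (simp add: field_simps)
        hence "?b * r ^ k \<le> real k * (1 / p) ^ m * r ^ k"
          using r by (intro mult_right_mono) auto
        also have "\<dots> = (real k * r ^ k) * (1 / p) ^ m" by simp
        also have "\<dots> \<le> C * (1 / p) ^ m" using C(2) by (intro mult_right_mono) auto
        finally show ?thesis using k by (simp add: coeff_linear_poly_power)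
      qed
    qed
    have eq: "om j m = [:w j m:] * (?X - 1) + [:w j m - 1:]"
      by (simp add: om_def Z_def smult_diff_right one_pCons)
    have "rbd r (1 * (C * (1 / p) ^ m)) (fps_of_poly ([:w j m:] * (?X - 1)))"
      unfolding fps_of_poly_mult fps_of_poly_const using X r by (intro rbd_mult) (auto simp: nabs_w)
    moreover have "nabs (w j m - 1) \<le> C * (1 / p) ^ m"
    proof -
      have "(1 / real p) ^ Suc m \<le> 1 * (1 / p) ^ m"
        using one_div_p_lt_1 by (simp add: power_decreasing divide_le_eq)
      also have "\<dots> \<le> C * (1 / p) ^ m" using C(1) by (intro mult_right_mono) auto
      finally show ?thesis using w_near_1[of j m] by linarith
    qed
    ultimately show ?thesis
      using r unfolding eq fps_of_poly_add fps_of_poly_const by (intro rbd_add) auto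
  qed
  thus ?thesis by blast
qed

text \<open>Each twist in \<open>omegaS\<close> contributes a factor (1/p)^m. Replacing
  \<open>card J'\<close> by \<open>card J\<close> in the bound for the cofactor makes the constant
  independent of \<open>J'\<close>.\<close>

lemma xitilde_bound:
  assumes r: "0 \<le> r" "r < 1" and J: "finite J" "J \<noteq> {}"
  shows "\<exists>C\<ge>0. \<forall>m J'. J' \<subseteq> J \<longrightarrow>
    rbd r (C * ((1 / p) ^ card J) ^ m) (fps_of_poly (xitilde p u (Suc m) J' J - 1))"
proof -
  obtain C where C: "\<And>m j. rbd r (C * (1 / p) ^ m) (fps_of_poly (om j m))"
    using om_bound[OF r] by blast
  have C0: "0 \<le> C" using rbd_nonneg[OF C[of 0]] by simp
  have "rbd r (C ^ card J * real p ^ (card J * card J) * ((1 / p) ^ card J) ^ m)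
      (fps_of_poly (xitilde p u (Suc m) J' J - 1))" if J': "J' \<subseteq> J" for m J'
  proof -
    obtain K where K: "xitilde p u (Suc m) J' J = 1 + omegaS p u m J * K"
      "rbd 1 (real p ^ (card J' * card J)) (fps_of_poly K)"
      using xitilde_Suc[OF J J'] by blast
    have "rbd r (real p ^ (card J' * card J)) (fps_of_poly K)"
      using rbd_antimono[OF K(2)] r by simp
    moreover have "real p ^ (card J' * card J) \<le> real p ^ (card J * card J)"
      using p_gt_1 J J' by (intro power_increasing mult_right_mono card_mono) auto
    ultimately have "rbd r (real p ^ (card J * card J)) (fps_of_poly K)"
      using rbd_mono by blast
    moreover have "rbd r (\<Prod>j\<in>J. C * (1 / p) ^ m) (fps_of_poly (omegaS p u m J))"
      unfolding omegaS_eq fps_of_poly_prod using C r by (intro rbd_prod) auto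
    ultimately have "rbd r ((\<Prod>j\<in>J. C * (1 / p) ^ m) * real p ^ (card J * card J))
        (fps_of_poly (omegaS p u m J * K))"
      unfolding fps_of_poly_mult using r by (intro rbd_mult) auto
    also have "(\<Prod>j\<in>J. C * (1 / p) ^ m) * real p ^ (card J * card J)
        = C ^ card J * real p ^ (card J * card J) * ((1 / p) ^ card J) ^ m"
      by (simp only: prod_constant power_mult_distrib power_mult[symmetric] mult_ac)
    finally show ?thesis by (simp add: K(1))
  qed
  thus ?thesis using C0 p_gt_1 by (intro exI[of _ "C ^ card J * real p ^ (card J * card J)"]) auto
qed

end

section \<open>Growth of matrix powers\<close>

context nonarch_field
begin

text \<open>The root lies outside the open disc of radius \<open>r\<close>. With g the product,
  comparing coefficients gives \<mu> h(n+1) = h(n) - g(n+1), and since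
  \<open>r \<le> nabs \<mu>\<close> the bound \<open>B / r\<close> reproduces itself.\<close>

lemma rbd_divide_linear:
  assumes r: "0 < r" "r \<le> nabs \<mu>" and g: "rbd r B (fps_of_poly [:- \<mu>, 1:] * h)"
  shows "rbd r (B / r) h"
  unfolding rbd_def
proof
  fix n
  let ?g = "fps_of_poly [:- \<mu>, 1:] * h"
  have eq: "?g = fps_X * h - fps_const \<mu> * h"
    by (simp add: fps_of_poly_linear algebra_simps flip: fps_const_neg)
  have B: "0 \<le> B" using g rbd_nonneg by blast
  have div: "x \<le> B / r" if "nabs \<mu> * x \<le> B" "0 \<le> x" for x
    using mult_right_mono[OF r(2) that(2)] that(1) r(1) by (simp add: field_simps)
  show "nabs (fps_nth h n) * r ^ n \<le> B / r"
  proof (induction n)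
    case 0
    show ?case
      using rbdD[OF g, of 0] unfolding eq by (intro div) (simp_all add: nabs_mult)
  next
    case (Suc n)
    have "nabs (fps_nth h n) * r ^ Suc n \<le> B"
      using Suc r by (simp add: field_simps)
    moreover have "nabs (fps_nth ?g (Suc n)) * r ^ Suc n \<le> B"
      using rbdD[OF g] by blast
    moreover have "\<mu> * fps_nth h (Suc n) = fps_nth h n - fps_nth ?g (Suc n)"
      unfolding eq by simp
    hence "nabs \<mu> * nabs (fps_nth h (Suc n)) \<le> max (nabs (fps_nth h n)) (nabs (fps_nth ?g (Suc n)))"
      by (metis nabs_diff nabs_mult)
    hence "nabs \<mu> * nabs (fps_nth h (Suc n)) * r ^ Suc n
        \<le> max (nabs (fps_nth h n)) (nabs (fps_nth ?g (Suc n))) * r ^ Suc n"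
      using r by (intro mult_right_mono) auto
    ultimately have "nabs \<mu> * nabs (fps_nth h (Suc n)) * r ^ Suc n \<le> B"
      by (auto simp: max_def split: if_splits)
    thus ?case
      using r by (intro div) (simp_all add: mult.assoc)
  qed
qed

text \<open>A polynomial without roots in the open disc of radius \<open>r\<close> is divided out
  one linear factor at a time; the bound worsens by a factor depending only on \<open>D\<close> and
  \<open>r\<close>.\<close>

lemma rbd_divide_poly:
  assumes closed: "\<forall>q::'k poly. 0 < degree q \<longrightarrow> (\<exists>z. poly q z = 0)"
    and r: "0 < r" and "D \<noteq> 0" and "\<And>\<mu>. poly D \<mu> = 0 \<Longrightarrow> r \<le> nabs \<mu>"
    and "rbd r B (fps_of_poly D * h)"
  shows "\<exists>B. rbd r B h"
  using assms(3-)
proof (induction "degree D" arbitrary: D B)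
  case 0
  then obtain c where D: "D = [:c:]" using degree_eq_zeroE by metis
  with 0 have "c \<noteq> 0" by simp
  have "rbd r (nabs (inverse c) * B) (fps_const (inverse c) * (fps_of_poly D * h))"
    using 0 r by (intro rbd_mult) auto
  also have "fps_const (inverse c) * (fps_of_poly D * h) = h"
    using \<open>c \<noteq> 0\<close> by (simp add: D fps_of_poly_const mult.assoc[symmetric])
  finally show ?case by blast
next
  case (Suc n)
  then obtain \<mu> where \<mu>: "poly D \<mu> = 0" using closed by (metis zero_less_Suc)
  then obtain D' where D': "D = [:- \<mu>, 1:] * D'" using poly_eq_0_iff_dvd by blast
  have nz: "D' \<noteq> 0" using Suc.prems(1) D' by auto
  have "degree D = Suc (degree D')"
    using nz unfolding D' by (subst degree_mult_eq) auto
  with Suc have deg: "n = degree D'" by simp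
  have "rbd r (B / r) (fps_of_poly D' * h)"
    using Suc.prems(2)[OF \<mu>] Suc.prems(3)[unfolded D' fps_of_poly_mult mult.assoc] r
    by (intro rbd_divide_linear[of r \<mu>])
  moreover have "r \<le> nabs z" if "poly D' z = 0" for z
    using Suc.prems(2)[of z] that by (simp add: D')
  ultimately show ?case using Suc.hyps(1)[OF deg nz] by blast
qed

text \<open>The generating series \<open>F = \<Sum>n. M ^ n X ^ n\<close> satisfies \<open>F (1 - X M) = 1\<close>; multiplying with
  the adjugate, \<open>det (1 - X M)\<close> times each entry of \<open>F\<close> is a polynomial, and the roots of
  the determinant are inverses of eigenvalues.\<close>

lemma mat_pow_bound:
  fixes M :: "'k mat"
  assumes closed: "\<forall>q::'k poly. 0 < degree q \<longrightarrow> (\<exists>z. poly q z = 0)"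
    and M: "M \<in> carrier_mat d d" and r: "0 < r"
    and roots: "\<And>\<mu>. det (1\<^sub>m d - \<mu> \<cdot>\<^sub>m M) = 0 \<Longrightarrow> r \<le> nabs \<mu>"
  shows "\<exists>C. \<forall>n. \<forall>i<d. \<forall>j<d. nabs ((M ^\<^sub>m n) $$ (i, j)) * r ^ n \<le> C"
proof -
  \<comment> \<open>The matrix \<open>1 - X M\<close>; its determinant \<open>D\<close> is the
    reversed characteristic polynomial of \<open>M\<close>.\<close>
  define P where "P = mat d d (\<lambda>(i, j). [: if i = j then 1 else 0, - M $$ (i, j) :])"
  define F where "F = mat d d (\<lambda>(i, j). Abs_fps (\<lambda>n. (M ^\<^sub>m n) $$ (i, j)))"
  define D where "D = det P"
  interpret fop: comm_ring_hom "fps_of_poly :: 'k poly \<Rightarrow> 'k fps"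
    by unfold_locales (simp_all add: fps_of_poly_add fps_of_poly_mult)
  let ?P = "map_mat fps_of_poly P"
  have carr: "P \<in> carrier_mat d d" "?P \<in> carrier_mat d d" "F \<in> carrier_mat d d"
    by (auto simp: P_def F_def)
  have Pent: "?P $$ (i, j) = (if i = j then 1 else 0) - fps_const (M $$ (i, j)) * fps_X"
    if "i < d" "j < d" for i j
    using that by (simp add: P_def fps_of_poly_pCons fps_of_poly_const flip: fps_const_neg)
  have FP: "F * ?P = 1\<^sub>m d"
  proof (rule eq_matI)
    fix i j assume "i < dim_row (1\<^sub>m d :: 'k fps mat)" "j < dim_col (1\<^sub>m d :: 'k fps mat)"
    hence ij: "i < d" "j < d" by auto
    have "(F * ?P) $$ (i, j) = (\<Sum>k = 0..<d. F $$ (i, k) * ?P $$ (k, j))"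
      using ij carr by (simp add: scalar_prod_def)
    also have "\<dots> = (\<Sum>k = 0..<d. (if k = j then F $$ (i, k) else 0)
        - F $$ (i, k) * fps_const (M $$ (k, j)) * fps_X)"
      using ij by (intro sum.cong) (auto simp: Pent algebra_simps)
    also have "\<dots> = F $$ (i, j) - (\<Sum>k = 0..<d. F $$ (i, k) * fps_const (M $$ (k, j))) * fps_X"
      using ij by (simp add: sum_subtractf sum_distrib_right)
    also have "\<dots> = 1\<^sub>m d $$ (i, j)"
    proof (rule fps_ext)
      fix n
      show "fps_nth (F $$ (i, j) - (\<Sum>k = 0..<d. F $$ (i, k) * fps_const (M $$ (k, j))) * fps_X) n
          = fps_nth (1\<^sub>m d $$ (i, j)) n"
      proof (cases n)
        case 0
        thus ?thesis using ij M by (simp add: F_def)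
      next
        case (Suc m)
        have "(M ^\<^sub>m Suc m) $$ (i, j) = (\<Sum>k = 0..<d. (M ^\<^sub>m m) $$ (i, k) * M $$ (k, j))"
          using ij M pow_carrier_mat[OF M, of m] by (simp add: scalar_prod_def)
        thus ?thesis using ij Suc by (simp add: F_def fps_sum_nth)
      qed
    qed
    finally show "(F * ?P) $$ (i, j) = 1\<^sub>m d $$ (i, j)" .
  qed (use carr in auto)
  have DF: "fps_of_poly D * F $$ (i, j) = fps_of_poly (adj_mat P $$ (i, j))" if ij: "i < d" "j < d" for i j
  proof -
    have adj: "adj_mat P \<in> carrier_mat d d" by (rule adj_mat(1)[OF carr(1)])
    have "?P * map_mat fps_of_poly (adj_mat P) = map_mat fps_of_poly (D \<cdot>\<^sub>m 1\<^sub>m d)"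
      using fop.mat_hom_mult[OF carr(1) adj] adj_mat(2)[OF carr(1)] by (simp add: D_def)
    hence "F * map_mat fps_of_poly (D \<cdot>\<^sub>m 1\<^sub>m d) = (F * ?P) * map_mat fps_of_poly (adj_mat P)"
      using carr adj by (subst assoc_mult_mat[of _ d d _ d _ d]) auto
    also have "\<dots> = map_mat fps_of_poly (adj_mat P)"
      using adj FP by simp
    finally have "(F * map_mat fps_of_poly (D \<cdot>\<^sub>m 1\<^sub>m d)) $$ (i, j) = fps_of_poly (adj_mat P $$ (i, j))"
      using ij adj by simp
    moreover have "map_mat fps_of_poly (D \<cdot>\<^sub>m 1\<^sub>m d) = fps_of_poly D \<cdot>\<^sub>m 1\<^sub>m d"
      by (rule eq_matI) auto
    ultimately show ?thesis
      using ij carr by simp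
  qed
  have polyD: "poly D \<mu> = det (1\<^sub>m d - \<mu> \<cdot>\<^sub>m M)" for \<mu>
    unfolding D_def using M by (intro poly_det_cong[of _ d]) (auto simp: P_def)
  \<comment> \<open>A root at 0 would force \<open>r \<le> 0\<close>.\<close>
  have "poly D 0 \<noteq> 0"
    using roots[of 0] r unfolding polyD by force
  hence D0: "D \<noteq> 0" by auto
  have "\<exists>B. rbd r B (F $$ (i, j))" if "i < d" "j < d" for i j
  proof -
    obtain B where "rbd r B (fps_of_poly (adj_mat P $$ (i, j)))"
      using rbd_fps_of_poly_ex by blast
    thus ?thesis
      using rbd_divide_poly[OF closed r D0, of B "F $$ (i, j)"] roots polyD DF[OF that] by auto
  qed
  then obtain b where b: "\<And>i j. i < d \<Longrightarrow> j < d \<Longrightarrow> rbd r (b i j) (F $$ (i, j))" by metis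
  have "nabs ((M ^\<^sub>m n) $$ (i, j)) * r ^ n \<le> (\<Sum>i<d. \<Sum>j<d. b i j)" if "i < d" "j < d" for n i j
  proof -
    have nn: "0 \<le> b i j" if "i < d" "j < d" for i j using b[OF that] rbd_nonneg by blast
    have "nabs ((M ^\<^sub>m n) $$ (i, j)) * r ^ n \<le> b i j"
      using rbdD[OF b[OF that], of n] that by (simp add: F_def)
    also have "\<dots> \<le> (\<Sum>j<d. b i j)"
      using that nn by (intro member_le_sum) auto
    also have "\<dots> \<le> (\<Sum>i<d. \<Sum>j<d. b i j)"
      using that nn by (intro member_le_sum[of i "{..<d}" "\<lambda>i. \<Sum>j<d. b i j"]) (auto intro!: sum_nonneg)
    finally show ?thesis .
  qed
  thus ?thesis by blast
qed

end

text \<open>The eigenvalues of \<open>A\<close> have absolute values between p^(-Max NV) and p^(-Min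
  NV). The roots of det(1 - \<mu> A) are their inverses, those of det(1 - \<mu> B) the eigenvalues
  themselves, so the powers of \<open>A\<close> grow at most like p^(-n Min NV) and those of
  \<open>B\<close> like p^(n Max NV).\<close>

lemma mat_pow_newton_bound:
  fixes iota :: "'k::field \<Rightarrow> 'K::field" and A B :: "'k mat"
  assumes closure: "is_alg_closure_valued nabs iota nabsK"
    and AB: "A \<in> carrier_mat d d" "B \<in> carrier_mat d d" "A * B = 1\<^sub>m d" and "0 < d" and p: "1 < p"
  defines "NV \<equiv> newton_vals p iota nabsK A"
  shows "finite NV" "NV \<noteq> {}"
    "\<exists>C. \<forall>n. \<forall>i<d. \<forall>j<d. \<forall>k<d. \<forall>l<d. nabs ((A ^\<^sub>m n) $$ (i, j)) * nabs ((B ^\<^sub>m n) $$ (k, l))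
       \<le> C * (real p powr (Max NV - Min NV)) ^ n"
proof -
  have io: "iota (x + y) = iota x + iota y" "iota (x * y) = iota x * iota y" "iota 1 = 1"
    "nabsK (iota x) = nabs x" for x y
    using closure unfolding is_alg_closure_valued_def by auto
  have closed: "\<forall>q::'K poly. 0 < degree q \<longrightarrow> (\<exists>z. poly q z = 0)"
    using closure unfolding is_alg_closure_valued_def by auto
  interpret K: nonarch_field nabsK
    using closure by unfold_locales (auto simp: is_alg_closure_valued_def)
  have io0: "iota 0 = 0"
    using io(1)[of 0 0] by (metis add_0_right add_cancel_left_right)
  interpret iota: comm_ring_hom iota
    by unfold_locales (use io0 in \<open>auto simp: io\<close>)
  let ?A = "map_mat iota A" and ?B = "map_mat iota B"
  have carr: "?A \<in> carrier_mat d d" "?B \<in> carrier_mat d d"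
    using AB by auto
  have AB': "?A * ?B = 1\<^sub>m d"
    using iota.mat_hom_mult[OF AB(1,2)] AB(3) by (simp add: iota.mat_hom_one)
  define R where "R = {l. poly (char_poly ?A) l = 0}"
  have NV: "NV = (\<lambda>l. - log (real p) (nabsK l)) ` R"
    unfolding NV_def newton_vals_def R_def using iota.char_poly_hom[OF AB(1)] by simp
  have deg: "degree (char_poly ?A) = d"
    using degree_monic_char_poly[OF carr(1)] by simp
  hence "char_poly ?A \<noteq> 0" using \<open>0 < d\<close> by force
  hence "finite R" unfolding R_def by (rule poly_roots_finite)
  thus fin: "finite NV" by (simp add: NV)
  have "R \<noteq> {}" using closed deg \<open>0 < d\<close> unfolding R_def by auto
  thus "NV \<noteq> {}" by (simp add: NV)
  have root: "l \<in> R \<longleftrightarrow> det (l \<cdot>\<^sub>m 1\<^sub>m d - ?A) = 0" for l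
  proof -
    have "- char_matrix ?A l = l \<cdot>\<^sub>m 1\<^sub>m d - ?A"
      using AB(1) by (intro eq_matI) (auto simp: char_matrix_def)
    thus ?thesis unfolding R_def using char_poly_matrix[OF carr(1), of l] by simp
  qed
  have detA: "det ?A \<noteq> 0"
    using det_mult[OF carr] AB' by auto
  have R0: "l \<noteq> 0" if "l \<in> R" for l
  proof
    assume "l = 0"
    hence "det (- ?A) = 0"
    proof -
      have "(0::'K) \<cdot>\<^sub>m 1\<^sub>m d - ?A = - ?A" using AB(1) by (intro eq_matI) auto
      thus ?thesis using that root \<open>l = 0\<close> by metis
    qed
    thus False using det_0_negate[OF carr(1)] detA by simp
  qed
  have powr: "real p powr (- (- log (real p) (nabsK l))) = nabsK l" if "l \<in> R" for l
    using p R0[OF that] by simp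
  have upper: "nabsK l \<le> real p powr (- Min NV)" if "l \<in> R" for l
  proof -
    have "Min NV \<le> - log (real p) (nabsK l)"
      using that fin by (intro Min_le) (auto simp: NV)
    thus ?thesis using p powr[OF that] powr_mono[of "- (- log (real p) (nabsK l))" "- Min NV" "real p"] by simp
  qed
  have lower: "real p powr (- Max NV) \<le> nabsK l" if "l \<in> R" for l
  proof -
    have "- log (real p) (nabsK l) \<le> Max NV"
      using that fin by (intro Max_ge) (auto simp: NV)
    thus ?thesis using p powr[OF that] powr_mono[of "- Max NV" "- (- log (real p) (nabsK l))" "real p"] by simp
  qed
  have "\<exists>C. \<forall>n. \<forall>i<d. \<forall>j<d. nabsK ((?A ^\<^sub>m n) $$ (i, j)) * (real p powr (Min NV)) ^ n \<le> C"
  proof (rule K.mat_pow_bound[OF closed carr(1)])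
    fix \<mu> assume *: "det (1\<^sub>m d - \<mu> \<cdot>\<^sub>m ?A) = 0"
    have "\<mu> \<noteq> 0"
    proof
      assume "\<mu> = 0"
      hence "1\<^sub>m d - \<mu> \<cdot>\<^sub>m ?A = 1\<^sub>m d" using AB(1) by (intro eq_matI) auto
      thus False using * by simp
    qed
    have "inverse \<mu> \<cdot>\<^sub>m 1\<^sub>m d - ?A = inverse \<mu> \<cdot>\<^sub>m (1\<^sub>m d - \<mu> \<cdot>\<^sub>m ?A)"
      using AB(1) \<open>\<mu> \<noteq> 0\<close> by (intro eq_matI) (auto simp: algebra_simps)
    hence "inverse \<mu> \<in> R" unfolding root by (simp add: *)
    from upper[OF this] have "inverse (nabsK \<mu>) \<le> inverse (real p powr Min NV)"
      by (simp add: K.nabs_inverse powr_minus)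
    thus "real p powr Min NV \<le> nabsK \<mu>"
      using p \<open>\<mu> \<noteq> 0\<close> by (simp add: inverse_le_iff_le)
  qed (use p in simp)
  then obtain C1 where C1: "\<And>n i j. i < d \<Longrightarrow> j < d \<Longrightarrow>
      nabsK ((?A ^\<^sub>m n) $$ (i, j)) * (real p powr (Min NV)) ^ n \<le> C1" by blast
  have "\<exists>C. \<forall>n. \<forall>i<d. \<forall>j<d. nabsK ((?B ^\<^sub>m n) $$ (i, j)) * (real p powr (- Max NV)) ^ n \<le> C"
  proof (rule K.mat_pow_bound[OF closed carr(2)])
    fix \<mu> assume *: "det (1\<^sub>m d - \<mu> \<cdot>\<^sub>m ?B) = 0"
    have c: "\<mu> \<cdot>\<^sub>m ?B \<in> carrier_mat d d" "1\<^sub>m d \<in> carrier_mat d d" "- ?A \<in> carrier_mat d d"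
      using carr by auto
    \<comment> \<open>Multiplication by \<open>- A\<close> turns \<open>1 - \<mu> B\<close> into
      \<open>\<mu> - A\<close>, so a root for \<open>B\<close> is an eigenvalue of
      \<open>A\<close>.\<close>
    have "(- ?A) * (1\<^sub>m d - \<mu> \<cdot>\<^sub>m ?B) = - ?A - (- ?A) * (\<mu> \<cdot>\<^sub>m ?B)"
      using c by (subst mult_minus_distrib_mat[of _ d d]) auto
    also have "(- ?A) * (\<mu> \<cdot>\<^sub>m ?B) = - (\<mu> \<cdot>\<^sub>m (?A * ?B))"
      using carr AB' by (simp add: mult_smult_distrib) (intro eq_matI; simp)
    also have "- ?A - - (\<mu> \<cdot>\<^sub>m (?A * ?B)) = \<mu> \<cdot>\<^sub>m 1\<^sub>m d - ?A"
      unfolding AB' using AB(1) by (intro eq_matI) auto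
    finally have "det (\<mu> \<cdot>\<^sub>m 1\<^sub>m d - ?A) = 0"
      using det_mult[OF c(3) minus_carrier_mat[OF c(1)], of "1\<^sub>m d"] * by simp
    thus "real p powr (- Max NV) \<le> nabsK \<mu>"
      using lower root by blast
  qed (use p in simp)
  then obtain C2 where C2: "\<And>n i j. i < d \<Longrightarrow> j < d \<Longrightarrow>
      nabsK ((?B ^\<^sub>m n) $$ (i, j)) * (real p powr (- Max NV)) ^ n \<le> C2" by blast
  have "nabs ((A ^\<^sub>m n) $$ (i, j)) * nabs ((B ^\<^sub>m n) $$ (k, l)) \<le> C1 * C2 * (real p powr (Max NV - Min NV)) ^ n"
    if ij: "i < d" "j < d" "k < d" "l < d" for n i j k l
  proof -
    have ent: "nabsK ((?A ^\<^sub>m n) $$ (i, j)) = nabs ((A ^\<^sub>m n) $$ (i, j))"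
      "nabsK ((?B ^\<^sub>m n) $$ (k, l)) = nabs ((B ^\<^sub>m n) $$ (k, l))"
      using ij AB by (simp_all flip: iota.mat_hom_pow add: io)
    let ?s = "real p powr Min NV" and ?t = "real p powr (- Max NV)" and ?w = "real p powr (Max NV - Min NV)"
    have "(nabs ((A ^\<^sub>m n) $$ (i, j)) * ?s ^ n) * (nabs ((B ^\<^sub>m n) $$ (k, l)) * ?t ^ n) \<le> C1 * C2"
      unfolding ent[symmetric]
      by (rule mult_mono[OF C1[OF ij(1,2)] C2[OF ij(3,4)]])
        (use order_trans[OF _ C1[OF ij(1,2), of n]] in \<open>auto intro!: mult_nonneg_nonneg\<close>)
    hence "nabs ((A ^\<^sub>m n) $$ (i, j)) * ?s ^ n * (nabs ((B ^\<^sub>m n) $$ (k, l)) * ?t ^ n) * ?w ^ n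
        \<le> C1 * C2 * ?w ^ n"
      by (rule mult_right_mono) simp
    moreover have "?s ^ n * ?t ^ n * ?w ^ n = 1"
      unfolding power_mult_distrib[symmetric] using p by (simp flip: powr_add)
    moreover have "nabs ((A ^\<^sub>m n) $$ (i, j)) * ?s ^ n * (nabs ((B ^\<^sub>m n) $$ (k, l)) * ?t ^ n) * ?w ^ n
        = nabs ((A ^\<^sub>m n) $$ (i, j)) * nabs ((B ^\<^sub>m n) $$ (k, l)) * (?s ^ n * ?t ^ n * ?w ^ n)"
      by (simp only: mult_ac)
    ultimately show ?thesis by (metis mult_1_right)
  qed
  thus "\<exists>C. \<forall>n. \<forall>i<d. \<forall>j<d. \<forall>k<d. \<forall>l<d. nabs ((A ^\<^sub>m n) $$ (i, j)) * nabs ((B ^\<^sub>m n) $$ (k, l))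
       \<le> C * (real p powr (Max NV - Min NV)) ^ n" by blast
qed

section \<open>Hodge--Tate weights and matrices of linear maps\<close>

lemma size_sum_mset:
  fixes f :: "'a \<Rightarrow> 'b multiset"
  shows "size (\<Sum>i\<in>A. f i) = (\<Sum>i\<in>A. size (f i))"
  by (induction A rule: infinite_finite_induct) simp_all

lemma filtration_antimono:
  assumes "is_filtration scale Fil" "i \<le> j"
  shows "Fil j \<subseteq> Fil i"
  using assms(2)
proof (induction j rule: int_ge_induct)
  case (step j)
  thus ?case using assms(1) unfolding is_filtration_def by blast
qed simp

text \<open>Subtraction of natural numbers is truncated; monotonicity keeps every difference
  exact.\<close>

lemma sum_telescope_antimono:
  fixes D :: "int \<Rightarrow> nat"
  assumes anti: "\<And>i j. i \<le> j \<Longrightarrow> D j \<le> D i"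
  shows "(\<Sum>i\<in>{a..<a + int n}. D i - D (i + 1)) = D a - D (a + int n)"
proof (induction n)
  case (Suc n)
  have eq: "{a..<a + int (Suc n)} = insert (a + int n) {a..<a + int n}" by auto
  have "D (a + int n + 1) \<le> D (a + int n)" "D (a + int n) \<le> D a"
    by (rule anti; simp)+
  moreover have e: "D (a + int (Suc n)) = D (a + int n + 1)"
    by (rule arg_cong[of _ _ D]) simp
  ultimately show ?case unfolding eq e using Suc by simp
qed simp

text \<open>The filtration is everything far down and zero far up, so the drops in dimension add up
  to the full dimension. The count guarantees that \<open>tHT\<close> reads its list within
  range.\<close>

lemma (in finite_dimensional_vector_space) size_HT_mset:
  assumes "Basis \<noteq> {}" and fil: "is_filtration scale Fil"
  shows "size (HT_mset scale Fil) = dim (UNIV :: 'b set)"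
proof -
  note anti = filtration_antimono[OF fil]
  have sub: "subspace (Fil i)" for i using fil by (simp add: is_filtration_def)
  have "\<exists>i. b \<in> Fil i" for b using fil unfolding is_filtration_def by blast
  then obtain lev where lev: "\<And>b. b \<in> Fil (lev b)" by metis
  \<comment> \<open>A step of least dimension: all later steps equal it, so it lies in the whole
    intersection, which is zero.\<close>
  obtain i1 where i1: "\<And>i. dim (Fil i1) \<le> dim (Fil i)"
    using ex_has_least_nat[of "\<lambda>_. True" 0 "\<lambda>i. dim (Fil i)"] by blast
  have "Fil i1 \<subseteq> Fil i" for i
  proof (cases "i \<le> i1")
    case False
    hence "Fil i = Fil i1"
      using anti[of i1 i] i1[of i] by (intro subspace_dim_equal sub) simp_all
    thus ?thesis by simp
  qed (rule anti)
  hence "Fil i1 \<subseteq> (\<Inter>i. Fil i)" by blast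
  hence i1_0: "Fil i1 = {0}"
    using fil subspace_0[OF sub, of i1] unfolding is_filtration_def by auto
  \<comment> \<open>No basis vector has a level below \<open>a\<close>, hence \<open>Fil a\<close>
    is everything; the minimum with \<open>i1\<close> ensures \<open>a \<le> i1\<close>.\<close>
  define a where "a = min i1 (Min (lev ` Basis))"
  have "Basis \<subseteq> Fil a"
  proof
    fix b assume "b \<in> Basis"
    hence "a \<le> lev b" using finite_Basis by (auto simp: a_def min_le_iff_disj)
    thus "b \<in> Fil a" using lev anti by blast
  qed
  hence a: "Fil a = UNIV"
    using span_minimal[OF _ sub] span_Basis by blast
  have high: "Fil i = {0}" if "i1 \<le> i" for i
    using anti[OF that] i1_0 subspace_0[OF sub] by blast
  have low: "Fil i = UNIV" if "i \<le> a" for i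
    using anti[OF that] a by blast
  define n where "n = nat (i1 - a)"
  have n: "i1 = a + int n" by (simp add: n_def a_def)
  have jumps: "{i. Fil i \<noteq> Fil (i + 1)} \<subseteq> {a..<a + int n}"
  proof
    fix i assume "i \<in> {i. Fil i \<noteq> Fil (i + 1)}"
    hence i: "Fil i \<noteq> Fil (i + 1)" by blast
    have "\<not> i + 1 \<le> a"
    proof
      assume "i + 1 \<le> a"
      hence "i \<le> a" by linarith
      show False using i unfolding low[OF \<open>i \<le> a\<close>] low[OF \<open>i + 1 \<le> a\<close>] by blast
    qed
    moreover have "\<not> i1 \<le> i"
    proof
      assume "i1 \<le> i"
      hence "i1 \<le> i + 1" by linarith
      show False using i unfolding high[OF \<open>i1 \<le> i\<close>] high[OF \<open>i1 \<le> i + 1\<close>] by blast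
    qed
    ultimately show "i \<in> {a..<a + int n}" using n by (simp del: of_nat_Suc)
  qed
  have "size (HT_mset scale Fil) = (\<Sum>i | Fil i \<noteq> Fil (i + 1). dim (Fil i) - dim (Fil (i + 1)))"
    by (simp add: HT_mset_def size_sum_mset)
  also have "\<dots> = (\<Sum>i\<in>{a..<a + int n}. dim (Fil i) - dim (Fil (i + 1)))"
  proof (rule sum.mono_neutral_left)
    show "\<forall>i\<in>{a..<a + int n} - {i. Fil i \<noteq> Fil (i + 1)}. dim (Fil i) - dim (Fil (i + 1)) = 0"
      by simp
  qed (use jumps in simp_all)
  also have "\<dots> = dim (Fil a) - dim (Fil (a + int n))"
    by (rule sum_telescope_antimono) (intro dim_subset anti)
  also have "dim (Fil (a + int n)) = 0" unfolding n[symmetric] i1_0 by simp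
  finally show ?thesis unfolding a by simp
qed

lemma tHT_mono:
  assumes "size (HT_mset scale Fil) = d" "1 \<le> k" "k \<le> d"
  shows "tHT scale Fil 1 \<le> tHT scale Fil k"
proof -
  have "length (sorted_list_of_multiset (HT_mset scale Fil)) = d"
    using assms(1) by (metis mset_sorted_list_of_multiset size_mset)
  thus ?thesis
    using assms(2,3) unfolding tHT_def by (intro sorted_nth_mono) auto
qed

text \<open>A \<open>LEAST\<close> over the integers is informative only if a minimum exists; here
  it is exhibited as the larger of \<open>td\<close> and the floor of \<open>Max NV - Min NV\<close>
  plus \<open>1 + t1\<close>.\<close>

lemma tHT'_d_bounds:
  "td \<le> tHT'_d t1 td NV" "Max NV - Min NV < real_of_int (tHT'_d t1 td NV - t1)"
proof -
  define m where "m = max td (\<lfloor>Max NV - Min NV\<rfloor> + 1 + t1)"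
  have "tHT'_d t1 td NV = m"
    unfolding tHT'_d_def
  proof (rule Least_equality)
    show "td \<le> m \<and> Max NV - Min NV < real_of_int (m - t1)"
      unfolding m_def by linarith
    fix y assume "td \<le> y \<and> Max NV - Min NV < real_of_int (y - t1)"
    thus "m \<le> y" unfolding m_def by (simp add: floor_less_iff flip: int_less_real_le) linarith
  qed
  thus "td \<le> tHT'_d t1 td NV" "Max NV - Min NV < real_of_int (tHT'_d t1 td NV - t1)"
    unfolding m_def by linarith+
qed

section \<open>Coordinate matrices of linear maps\<close>

context vector_space
begin

lemma mat_of_map_comp:
  assumes v: "inj_on v {1..d}" "independent (v ` {1..d})" "span (v ` {1..d}) = UNIV"
    and f: "Vector_Spaces.linear scale scale f"
  shows "mat_of_map scale d v (f \<circ> g) = mat_of_map scale d v f * mat_of_map scale d v g"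
proof (rule eq_matI)
  fix i j assume "i < dim_row (mat_of_map scale d v f * mat_of_map scale d v g)"
    "j < dim_col (mat_of_map scale d v f * mat_of_map scale d v g)"
  hence ij: "i < d" "j < d" by (auto simp: mat_of_map_def)
  interpret f: Vector_Spaces.linear scale scale f by (rule f)
  let ?R = "representation (v ` {1..d})"
  have UN: "x \<in> span (v ` {1..d})" for x unfolding v(3) by simp
  have "g (v (j + 1)) = (\<Sum>b\<in>v ` {1..d}. scale (?R (g (v (j + 1))) b) b)"
    using sum_representation_eq[OF v(2) UN] by simp
  also have "\<dots> = (\<Sum>k\<in>{1..d}. scale (?R (g (v (j + 1))) (v k)) (v k))"
    using v(1) by (simp add: sum.reindex)
  \<comment> \<open>Basis vectors are numbered from 1, matrix rows and columns from 0.\<close>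
  also have "\<dots> = (\<Sum>k = 0..<d. scale (?R (g (v (j + 1))) (v (k + 1))) (v (k + 1)))"
    by (rule sum.reindex_bij_witness[of _ Suc "\<lambda>k. k - 1"]) auto
  finally have fg: "f (g (v (j + 1))) = (\<Sum>k = 0..<d. scale (?R (g (v (j + 1))) (v (k + 1))) (f (v (k + 1))))"
    by (metis (no_types, lifting) f.sum f.scale sum.cong)
  have "?R (f (g (v (j + 1)))) (v (i + 1))
      = (\<Sum>k = 0..<d. ?R (g (v (j + 1))) (v (k + 1)) * ?R (f (v (k + 1))) (v (i + 1)))"
    unfolding fg
    by (subst representation_sum[OF v(2) UN]) (simp only: representation_scale[OF v(2) UN])
  thus "mat_of_map scale d v (f \<circ> g) $$ (i, j) = (mat_of_map scale d v f * mat_of_map scale d v g) $$ (i, j)"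
    using ij by (simp add: mat_of_map_def scalar_prod_def mult.commute)
qed (simp_all add: mat_of_map_def)

lemma mat_of_map_id:
  assumes "inj_on v {1..d}" "independent (v ` {1..d})"
  shows "mat_of_map scale d v id = 1\<^sub>m d"
proof (rule eq_matI)
  fix i j assume "i < dim_row (1\<^sub>m d :: 'a mat)" "j < dim_col (1\<^sub>m d :: 'a mat)"
  hence ij: "i < d" "j < d" by auto
  have "v (i + 1) = v (j + 1) \<longleftrightarrow> i = j"
    using inj_onD[OF assms(1), of "i + 1" "j + 1"] ij by auto
  thus "mat_of_map scale d v id $$ (i, j) = 1\<^sub>m d $$ (i, j)"
    using ij representation_basis[OF assms(2), of "v (j + 1)"] by (auto simp: mat_of_map_def)
qed (simp_all add: mat_of_map_def)

lemma linear_funpow: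
  assumes "Vector_Spaces.linear scale scale f"
  shows "Vector_Spaces.linear scale scale (f ^^ n)"
proof (induction n)
  case 0
  thus ?case using linear_id by (simp add: id_def)
next
  case (Suc n)
  thus ?case unfolding funpow.simps using assms by (rule Vector_Spaces.linear_compose)
qed

lemma mat_of_map_funpow:
  assumes "inj_on v {1..d}" "independent (v ` {1..d})" "span (v ` {1..d}) = UNIV"
    and "Vector_Spaces.linear scale scale f"
  shows "mat_of_map scale d v (f ^^ n) = mat_of_map scale d v f ^\<^sub>m n"
proof (induction n)
  case 0
  thus ?case using mat_of_map_id[OF assms(1,2)] by (simp add: id_def mat_of_map_def)
next
  case (Suc n)
  thus ?case
    unfolding funpow_Suc_right mat_of_map_comp[OF assms(1-3) linear_funpow[OF assms(4)]] by simp
qed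

lemma linear_inv_of_bij:
  assumes "Vector_Spaces.linear scale scale f" "bij f"
  shows "Vector_Spaces.linear scale scale (Hilbert_Choice.inv f)"
proof -
  interpret f: Vector_Spaces.linear scale scale f by (rule assms)
  have eq: "Hilbert_Choice.inv f y = x" if "f x = y" for x y
    using assms(2) that by (metis bij_inv_eq_iff)
  have f_inv: "f (Hilbert_Choice.inv f y) = y" for y
    using assms(2) by (metis bij_inv_eq_iff)
  show ?thesis
    by unfold_locales (auto intro!: eq simp: f.add f.scale f_inv)
qed

end

section \<open>The infinite product\<close>

text \<open>Since \<open>P * Q = 1\<close>, conjugating a diagonal matrix \<open>T\<close> gives
  \<open>1 + P (T - 1) Q\<close>. This form isolates the differences \<open>x k - 1\<close>, which
  carry both the divisibility and the smallness.\<close>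

lemma mult_diag_mult_index:
  fixes P Q :: "'a::comm_ring_1 mat"
  assumes "P \<in> carrier_mat d d" "Q \<in> carrier_mat d d" "P * Q = 1\<^sub>m d" "i < d" "j < d"
  shows "(P * mat d d (\<lambda>(i, j). if i = j then x i else 0) * Q) $$ (i, j)
    = 1\<^sub>m d $$ (i, j) + (\<Sum>k<d. P $$ (i, k) * Q $$ (k, j) * (x k - 1))"
proof -
  let ?T = "mat d d (\<lambda>(i, j). if i = j then x i else 0)"
  have PT: "(P * ?T) $$ (i, k) = P $$ (i, k) * x k" if "k < d" for k
    using assms that by (simp add: scalar_prod_def if_distrib[of "(*) _"] cong: if_cong)
  have "(P * ?T * Q) $$ (i, j) = (\<Sum>k<d. P $$ (i, k) * x k * Q $$ (k, j))"
    using assms PT by (simp add: scalar_prod_def lessThan_atLeast0)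
  moreover have "1\<^sub>m d $$ (i, j) = (\<Sum>k<d. P $$ (i, k) * Q $$ (k, j))"
    unfolding assms(3)[symmetric] using assms(1,2,4,5) by (simp add: scalar_prod_def lessThan_atLeast0)
  ultimately show ?thesis by (simp add: sum.distrib[symmetric] algebra_simps)
qed

lemma pow_mat_mult_pow_mat_inverse:
  fixes A B :: "'a::comm_ring_1 mat"
  assumes "A \<in> carrier_mat d d" "B \<in> carrier_mat d d" "A * B = 1\<^sub>m d"
  shows "A ^\<^sub>m n * B ^\<^sub>m n = 1\<^sub>m d"
proof (induction n)
  case (Suc n)
  have c: "A ^\<^sub>m n \<in> carrier_mat d d" "B ^\<^sub>m n \<in> carrier_mat d d"
    using assms by auto
  have comm: "B ^\<^sub>m n * B = B * B ^\<^sub>m n" for n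
  proof (induction n)
    case (Suc n)
    have cB: "B ^\<^sub>m n \<in> carrier_mat d d" using assms by auto
    show ?case using Suc assms(2) cB by (simp add: assoc_mult_mat[of _ d d _ d _ d])
  qed (use assms in auto)
  have "A ^\<^sub>m Suc n * B ^\<^sub>m Suc n = A ^\<^sub>m n * A * (B * B ^\<^sub>m n)" by (simp add: comm)
  also have "\<dots> = A ^\<^sub>m n * ((A * B) * B ^\<^sub>m n)"
    using c assms(1,2) by (simp add: assoc_mult_mat[of _ d d _ d _ d])
  also have "\<dots> = 1\<^sub>m d" using Suc unfolding assms(3) left_mult_one_mat[OF c(2)] .
  finally show ?case .
qed (use assms in simp)

lemma (in nonarch_field) Hconv_det:
  assumes "\<And>n. F n \<in> carrier_mat d d" "L \<in> carrier_mat d d"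
    and "\<And>i j. i < d \<Longrightarrow> j < d \<Longrightarrow> Hconv nabs (\<lambda>n. F n $$ (i, j)) (L $$ (i, j))"
  shows "Hconv nabs (\<lambda>n. det (F n)) (det L)"
proof -
  have sgn: "inH nabs (signof \<pi>)" for \<pi>
    by (cases \<pi> rule: sign_cases) (auto intro: inH_uminus)
  have "Hconv nabs (\<lambda>n. \<Sum>\<pi> | \<pi> permutes {0..<d}. signof \<pi> * (\<Prod>i = 0..<d. F n $$ (i, \<pi> i)))
      (\<Sum>\<pi> | \<pi> permutes {0..<d}. signof \<pi> * (\<Prod>i = 0..<d. L $$ (i, \<pi> i)))"
  proof (intro Hconv_sum Hconv_mult Hconv_prod Hconv_const sgn)
    fix \<pi> i assume "\<pi> \<in> {\<pi>. \<pi> permutes {0..<d}}" "i \<in> {0..<d}"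
    hence "\<pi> i < d" "i < d" using permutes_in_image[of \<pi> "{0..<d}" i] by auto
    thus "Hconv nabs (\<lambda>n. F n $$ (i, \<pi> i)) (L $$ (i, \<pi> i))" by (simp add: assms(3))
  qed
  thus ?thesis by (simp add: det_def'[OF assms(1)] det_def'[OF assms(2)])
qed

section \<open>Convergence of the twisted product and its determinant\<close>

context padic_twist
begin

text \<open>The constant \<open>c\<close> stands for an entry of a power of \<phi> times an entry of
  the inverse power. Uniformity in \<open>J'\<close> and \<open>c\<close> lets all matrix entries
  share one threshold.\<close>

lemma xitilde_tendsto_1:
  assumes J: "finite J" "J \<noteq> {}" and W: "0 \<le> W" "W * (1 / p) ^ card J < 1"
    and r: "0 \<le> r" "r < 1" "0 < e"
  shows "\<exists>N. \<forall>m\<ge>N. \<forall>J'\<subseteq>J. \<forall>c. nabs c \<le> B * W ^ m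
    \<longrightarrow> rbd r e (fps_const c * (fps_of_poly (xitilde p u (Suc m) J' J) - 1))"
proof -
  let ?q = "(1 / real p) ^ card J"
  obtain C where C: "0 \<le> C" "\<And>m J'. J' \<subseteq> J \<Longrightarrow>
      rbd r (C * ?q ^ m) (fps_of_poly (xitilde p u (Suc m) J' J - 1))"
    using xitilde_bound[OF r(1,2) J] by blast
  have "(\<lambda>m. B * C * (W * ?q) ^ m) \<longlonglongrightarrow> B * C * 0"
    using W by (intro tendsto_mult_left LIMSEQ_power_zero) simp
  hence "\<forall>\<^sub>F m in sequentially. B * C * (W * ?q) ^ m < e"
    using r(3) by (intro order_tendstoD) auto
  then obtain N where N: "\<And>m. m \<ge> N \<Longrightarrow> B * C * (W * ?q) ^ m < e"
    unfolding eventually_sequentially by blast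
  have "rbd r e (fps_const c * (fps_of_poly (xitilde p u (Suc m) J' J) - 1))"
    if "m \<ge> N" "J' \<subseteq> J" "nabs c \<le> B * W ^ m" for m J' c
  proof -
    have "rbd r ((B * W ^ m) * (C * ?q ^ m)) (fps_const c * fps_of_poly (xitilde p u (Suc m) J' J - 1))"
      using C(2)[OF that(2)] that(3) r by (intro rbd_mult) auto
    moreover have "(B * W ^ m) * (C * ?q ^ m) \<le> e"
      using N[OF that(1)] by (simp add: power_mult_distrib mult_ac)
    ultimately have "rbd r e (fps_const c * fps_of_poly (xitilde p u (Suc m) J' J - 1))"
      using rbd_mono by blast
    thus ?thesis by (simp add: fps_of_poly_diff)
  qed
  thus ?thesis by blast
qed

text \<open>Shows that the \<open>THE\<close> in \<open>Xi\<close> denotes an actual limit. The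
  partial products obey a scalar recursion without conjugation, which is the case of growth rate
  \<open>W = 1\<close>.\<close>

lemma Hconv_Xi:
  assumes J: "finite J" "J \<noteq> {}" "J' \<subseteq> J"
  shows "Hconv nabs (\<lambda>M. fps_of_poly (\<Prod>m\<in>{N..M}. xitilde p u m J' J)) (Xi p nabs u N J' J)"
proof -
  let ?P = "\<lambda>M. fps_of_poly (\<Prod>m\<in>{N..M}. xitilde p u m J' J)"
  have "\<exists>f. Hconv nabs (\<lambda>M. ?P M) f"
  proof (rule Hconv_linear_recursion[of "{()}" "\<lambda>n _. ?P n" N
        "\<lambda>n _ _. fps_of_poly (xitilde p u (Suc n) J' J) - 1" "()"])
    fix n assume "N \<le> n"
    hence "{N..Suc n} = insert (Suc n) {N..n}" by auto
    thus "?P (Suc n) = ?P n + (\<Sum>k\<in>{()}. (fps_of_poly (xitilde p u (Suc n) J' J) - 1) * ?P n)"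
      by (simp add: fps_of_poly_mult algebra_simps)
  next
    fix r e :: real assume r: "0 \<le> r" "r < 1" "0 < e"
    have "(1 / real p) ^ card J < 1"
      using p_gt_1 J by (simp add: power_less_one_iff card_eq_0_iff one_less_power card_gt_0_iff)
    then obtain M where M: "\<forall>m\<ge>M. \<forall>J'\<subseteq>J. \<forall>c. nabs c \<le> 1 * 1 ^ m
        \<longrightarrow> rbd r e (fps_const c * (fps_of_poly (xitilde p u (Suc m) J' J) - 1))"
      using xitilde_tendsto_1[OF J(1,2) _ _ r, of 1 1] by auto
    have "rbd r e (fps_of_poly (xitilde p u (Suc m) J' J) - 1)" if "m \<ge> M" for m
      using M[rule_format, OF that J(3), of 1] by simp
    thus "\<exists>M. \<forall>n\<ge>M. \<forall>i\<in>{()}. \<forall>k\<in>{()}. rbd r e (fps_of_poly (xitilde p u (Suc n) J' J) - 1)"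
      by blast
  qed simp_all
  then obtain f where f: "Hconv nabs ?P f" by blast
  have "Xi p nabs u N J' J = f"
    unfolding Xi_def using f Hconv_unique by (intro the_equality) blast+
  thus ?thesis using f by simp
qed

lemma omegaS_Hdvd_xitilde:
  assumes "finite J" "J \<noteq> {}" "J' \<subseteq> J"
  shows "Hdvd nabs (fps_of_poly (omegaS p u m J)) (fps_of_poly (xitilde p u (Suc m) J' J) - 1)"
proof -
  obtain K where "xitilde p u (Suc m) J' J = 1 + omegaS p u m J * K"
    using xitilde_Suc[OF assms] by blast
  thus ?thesis
    unfolding Hdvd_def by (intro exI[of _ "fps_of_poly K"]) (simp add: fps_of_poly_add fps_of_poly_mult)
qed

text \<open>The vector space is gone: \<open>A\<close> and \<open>B\<close> play the matrices of
  \<phi> and its inverse. Writing \<open>S (Suc n) = 1 + E n\<close>, the entries of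
  \<open>E n\<close> are constant combinations of \<open>xitilde - 1\<close> at level
  \<open>Suc n\<close>, hence divisible by \<open>omegaS\<close> at level \<open>n\<close> and, by
  the growth hypothesis, tending to 0.\<close>

lemma twisted_product_limit:
  fixes A B :: "'k mat" and S Z :: "nat \<Rightarrow> 'k fps mat" and Js :: "nat \<Rightarrow> int set"
  assumes J: "finite J" "J \<noteq> {}" "\<And>k. k < d \<Longrightarrow> Js k \<subseteq> J"
    and A: "A \<in> carrier_mat d d" and B: "B \<in> carrier_mat d d" and AB: "A * B = 1\<^sub>m d"
    and W: "0 \<le> W" "W * (1 / p) ^ card J < 1"
    and growth: "\<And>n i j k l. i < d \<Longrightarrow> j < d \<Longrightarrow> k < d \<Longrightarrow> l < d \<Longrightarrow>
      nabs ((A ^\<^sub>m n) $$ (i, j)) * nabs ((B ^\<^sub>m n) $$ (k, l)) \<le> C * W ^ n"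
    and S: "\<And>n. S n = map_mat fps_const (A ^\<^sub>m (n + 1))
      * mat d d (\<lambda>(i, j). if i = j then fps_of_poly (xitilde p u n (Js i) J) else 0)
      * map_mat fps_const (B ^\<^sub>m (n + 1))"
    and Z0: "Z 0 = (if N = 0 then S 0 * 1\<^sub>m d else 1\<^sub>m d)"
    and ZSuc: "\<And>n. Z (Suc n) = (if N \<le> Suc n then S (Suc n) * Z n else 1\<^sub>m d)"
  shows "\<And>n i j. N \<le> n \<Longrightarrow> i < d \<Longrightarrow> j < d \<Longrightarrow>
      Hdvd nabs (fps_of_poly (omegaS p u n J)) ((Z (Suc n) - Z n) $$ (i, j))"
    and "\<exists>L. L \<in> carrier_mat d d \<and> (\<forall>i<d. \<forall>j<d. Hconv nabs (\<lambda>n. Z n $$ (i, j)) (L $$ (i, j)))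
      \<and> det L = (\<Prod>k<d. Xi p nabs u N (Js k) J)"
proof -
  let ?h = "map_mat fps_const :: 'k mat \<Rightarrow> 'k fps mat"
  interpret h: comm_ring_hom "fps_const :: 'k \<Rightarrow> 'k fps"
    by unfold_locales simp_all
  let ?x = "\<lambda>n k. fps_of_poly (xitilde p u n (Js k) J)"
  let ?T = "\<lambda>n. mat d d (\<lambda>(i, j). if i = j then ?x n i else 0)"
  have carr: "?h (A ^\<^sub>m n) \<in> carrier_mat d d" "?h (B ^\<^sub>m n) \<in> carrier_mat d d" for n
    using pow_carrier_mat[OF A, of n] pow_carrier_mat[OF B, of n] by auto
  have Scarr: "S n \<in> carrier_mat d d" for n
    unfolding S using carr[of "n + 1"] by (intro mult_carrier_mat) auto
  have Zcarr: "Z n \<in> carrier_mat d d" for n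
    by (induction n) (auto simp: Z0 ZSuc intro!: mult_carrier_mat Scarr)
  have hAB: "?h (A ^\<^sub>m n) * ?h (B ^\<^sub>m n) = 1\<^sub>m d" for n
    using h.mat_hom_mult[OF pow_carrier_mat[OF A] pow_carrier_mat[OF B], of n n]
    by (simp add: pow_mat_mult_pow_mat_inverse[OF A B AB] h.mat_hom_one)
  \<comment> \<open>The exponent is \<open>n + 2\<close> because \<open>E n\<close> belongs to
    \<open>S (Suc n)\<close>, which conjugates with the power \<open>Suc n + 1\<close>.\<close>
  define E where "E n i j = (\<Sum>k<d. fps_const ((A ^\<^sub>m (n + 2)) $$ (i, k) * (B ^\<^sub>m (n + 2)) $$ (k, j))
      * (?x (Suc n) k - 1))" for n i j
  have SE: "S (Suc n) $$ (i, j) = 1\<^sub>m d $$ (i, j) + E n i j" if ij: "i < d" "j < d" for n i j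
  proof -
    have "Suc n + 1 = n + 2" by simp
    hence "S (Suc n) $$ (i, j) = 1\<^sub>m d $$ (i, j) + (\<Sum>k<d. ?h (A ^\<^sub>m (n + 2)) $$ (i, k)
        * ?h (B ^\<^sub>m (n + 2)) $$ (k, j) * (?x (Suc n) k - 1))"
      unfolding S using mult_diag_mult_index[OF carr hAB ij] by metis
    also have "(\<Sum>k<d. ?h (A ^\<^sub>m (n + 2)) $$ (i, k) * ?h (B ^\<^sub>m (n + 2)) $$ (k, j) * (?x (Suc n) k - 1))
        = E n i j"
      unfolding E_def using ij A B pow_carrier_mat[OF A, of "n + 2"] pow_carrier_mat[OF B, of "n + 2"]
      by (intro sum.cong) (auto simp del: pow_mat.simps)
    finally show ?thesis .
  qed
  have rec: "Z (Suc n) $$ (i, j) = Z n $$ (i, j) + (\<Sum>l<d. E n i l * Z n $$ (l, j))"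
    if "N \<le> n" "i < d" "j < d" for n i j
  proof -
    have "Z (Suc n) $$ (i, j) = (\<Sum>l<d. S (Suc n) $$ (i, l) * Z n $$ (l, j))"
      using that Scarr[of "Suc n"] Zcarr[of n] by (simp add: ZSuc scalar_prod_def lessThan_atLeast0)
    also have "\<dots> = (\<Sum>l<d. (if l = i then Z n $$ (l, j) else 0) + E n i l * Z n $$ (l, j))"
      using that by (intro sum.cong) (auto simp: SE distrib_right)
    also have "\<dots> = Z n $$ (i, j) + (\<Sum>l<d. E n i l * Z n $$ (l, j))"
      using that by (simp add: sum.distrib)
    finally show ?thesis .
  qed
  have inH_h: "inH nabs (?h (A ^\<^sub>m n) $$ (i, j))" "inH nabs (?h (B ^\<^sub>m n) $$ (i, j))"
    if "i < d" "j < d" for n i j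
    using that A B by auto
  have inH_S: "inH nabs (S n $$ (i, j))" if "i < d" "j < d" for n i j
  proof -
    have "S n $$ (i, j) = 1\<^sub>m d $$ (i, j) + (\<Sum>k<d. ?h (A ^\<^sub>m (n + 1)) $$ (i, k)
        * ?h (B ^\<^sub>m (n + 1)) $$ (k, j) * (?x n k - 1))"
      unfolding S by (rule mult_diag_mult_index[OF carr hAB that])
    also have "inH nabs \<dots>"
      using that by (auto intro!: inH_add inH_sum inH_mult inH_diff inH_h simp del: pow_mat.simps)
    finally show ?thesis .
  qed
  have inH_Z: "inH nabs (Z n $$ (i, j))" if "i < d" "j < d" for n i j
    using that
  proof (induction n arbitrary: i j)
    case 0
    thus ?case using inH_S Scarr[of 0] by (simp add: Z0)
  next
    case (Suc n)
    thus ?case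
      using inH_S Scarr[of "Suc n"] Zcarr[of n]
      by (auto simp: ZSuc scalar_prod_def intro!: inH_sum inH_mult)
  qed
  show "Hdvd nabs (fps_of_poly (omegaS p u n J)) ((Z (Suc n) - Z n) $$ (i, j))"
    if n: "N \<le> n" "i < d" "j < d" for n i j
  proof -
    \<comment> \<open>Conjugation contributes only constants, so the divisibility of each
      \<open>xitilde - 1\<close> is inherited.\<close>
    have "Hdvd nabs (fps_of_poly (omegaS p u n J)) (E n i l)" for l
      unfolding E_def using J by (intro Hdvd_sum Hdvd_mult_left omegaS_Hdvd_xitilde) auto
    hence "Hdvd nabs (fps_of_poly (omegaS p u n J)) (\<Sum>l<d. Z n $$ (l, j) * E n i l)"
      using n inH_Z by (intro Hdvd_sum Hdvd_mult_left) auto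
    moreover have "(Z (Suc n) - Z n) $$ (i, j) = (\<Sum>l<d. Z n $$ (l, j) * E n i l)"
      using n Zcarr[of n] Zcarr[of "Suc n"] rec[OF n] by (simp add: mult.commute)
    ultimately show ?thesis by simp
  qed
  have "\<exists>f. Hconv nabs (\<lambda>n. Z n $$ (i, j)) f" if "i < d" "j < d" for i j
  \<comment> \<open>The column index \<open>j\<close> is fixed: each column satisfies the recursion
    by itself, with the same \<open>E\<close>.\<close>
  proof (rule Hconv_linear_recursion[of "{..<d}" "\<lambda>n i. Z n $$ (i, j)" N E])
    fix r e :: real assume r: "0 \<le> r" "r < 1" "0 < e"
    \<comment> \<open>The factor \<open>W ^ 2\<close> accounts for the two extra powers in
      \<open>E m\<close>.\<close>
    obtain M where M: "\<And>m J' c. m \<ge> M \<Longrightarrow> J' \<subseteq> J \<Longrightarrow> nabs c \<le> (C * W ^ 2) * W ^ m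
        \<Longrightarrow> rbd r e (fps_const c * (fps_of_poly (xitilde p u (Suc m) J' J) - 1))"
      using xitilde_tendsto_1[OF J(1,2) W r, of "C * W ^ 2"] by blast
    have "rbd r e (E m i l)" if "m \<ge> M" "i < d" "l < d" for m i l
      unfolding E_def
    proof (rule rbd_sum)
      fix k assume "k \<in> {..<d}"
      hence k: "k < d" by simp
      show "rbd r e (fps_const ((A ^\<^sub>m (m + 2)) $$ (i, k) * (B ^\<^sub>m (m + 2)) $$ (k, l)) * (?x (Suc m) k - 1))"
      proof (rule M[OF that(1) J(3)[OF k]])
        have "nabs ((A ^\<^sub>m (m + 2)) $$ (i, k)) * nabs ((B ^\<^sub>m (m + 2)) $$ (k, l)) \<le> C * W ^ (m + 2)"
          using that k by (intro growth)
        thus "nabs ((A ^\<^sub>m (m + 2)) $$ (i, k) * (B ^\<^sub>m (m + 2)) $$ (k, l)) \<le> C * W\<^sup>2 * W ^ m"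
          by (simp only: nabs_mult power_add mult_ac)
      qed
    qed (use r in auto)
    thus "\<exists>M. \<forall>n\<ge>M. \<forall>i\<in>{..<d}. \<forall>k\<in>{..<d}. rbd r e (E n i k)" by blast
  qed (use that inH_Z rec in auto)
  then obtain lim where lim: "\<And>i j. i < d \<Longrightarrow> j < d \<Longrightarrow> Hconv nabs (\<lambda>n. Z n $$ (i, j)) (lim i j)"
    by metis
  define L where "L = mat d d (\<lambda>(i, j). lim i j)"
  have L: "L \<in> carrier_mat d d" "\<And>i j. i < d \<Longrightarrow> j < d \<Longrightarrow> Hconv nabs (\<lambda>n. Z n $$ (i, j)) (L $$ (i, j))"
    using lim by (auto simp: L_def)
  have detS: "det (S n) = (\<Prod>k<d. ?x n k)" for n
  proof -
    have "det (?h (A ^\<^sub>m (n + 1))) * det (?h (B ^\<^sub>m (n + 1))) = 1"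
      unfolding det_mult[OF carr, symmetric] hAB by simp
    moreover have "det (?T n) = prod_list (diag_mat (?T n))"
      by (rule det_upper_triangular[of _ d]) auto
    hence "det (?T n) = (\<Prod>k<d. ?x n k)"
      by (simp add: prod_list_diag_prod lessThan_atLeast0)
    moreover have "det (S n) = det (?h (A ^\<^sub>m (n + 1))) * det (?T n) * det (?h (B ^\<^sub>m (n + 1)))"
      unfolding S using carr[of "n + 1"]
      by (subst det_mult[of _ d]; (subst det_mult[of _ d])?) (auto simp del: pow_mat.simps)
    ultimately show ?thesis by (simp add: mult_ac)
  qed
  have detZ: "det (Z n) = (\<Prod>k<d. fps_of_poly (\<Prod>m\<in>{N..n}. xitilde p u m (Js k) J))" for n
  proof (induction n)
    case 0
    show ?case using Scarr[of 0] by (simp add: Z0 detS)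
  next
    case (Suc n)
    show ?case
    \<comment> \<open>Below the starting index the range of the product is empty and
      \<open>Z\<close> is the identity.\<close>
    proof (cases "N \<le> Suc n")
      case True
      hence "{N..Suc n} = insert (Suc n) {N..n}" by auto
      hence "(\<Prod>k<d. fps_of_poly (\<Prod>m\<in>{N..Suc n}. xitilde p u m (Js k) J))
          = (\<Prod>k<d. ?x (Suc n) k) * (\<Prod>k<d. fps_of_poly (\<Prod>m\<in>{N..n}. xitilde p u m (Js k) J))"
        by (simp add: fps_of_poly_mult prod.distrib)
      thus ?thesis
        using True Suc det_mult[OF Scarr Zcarr, of "Suc n" n] by (simp add: ZSuc detS)
    qed (simp add: ZSuc)
  qed
  have "Hconv nabs (\<lambda>n. det (Z n)) (det L)"
    using Zcarr L by (intro Hconv_det) auto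
  moreover have "Hconv nabs (\<lambda>n. det (Z n)) (\<Prod>k<d. Xi p nabs u N (Js k) J)"
    unfolding detZ using J by (intro Hconv_prod Hconv_Xi) auto
  ultimately have "det L = (\<Prod>k<d. Xi p nabs u N (Js k) J)"
    by (rule Hconv_unique)
  thus "\<exists>L. L \<in> carrier_mat d d \<and> (\<forall>i<d. \<forall>j<d. Hconv nabs (\<lambda>n. Z n $$ (i, j)) (L $$ (i, j)))
      \<and> det L = (\<Prod>k<d. Xi p nabs u N (Js k) J)"
    using L by blast
qed

end

theorem mainTheorem8:
  fixes p :: nat and nabs :: "'k::field_char_0 \<Rightarrow> real" and u :: 'k
    and iota :: "'k \<Rightarrow> 'K::field" and nabsK :: "'K \<Rightarrow> real"
    and scale :: "'k \<Rightarrow> 'v::ab_group_add \<Rightarrow> 'v" and d :: nat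
    and phi :: "'v \<Rightarrow> 'v" and Fil :: "int \<Rightarrow> 'v set" and v :: "nat \<Rightarrow> 'v"
    and J :: "int set" and N :: nat
  assumes "prime p" and "odd p"
    and "is_Qp p nabs" and "top_generator p nabs u"
    and "is_alg_closure_valued nabs iota nabsK"
    and "vector_space scale" and "vector_space.dim scale (UNIV :: 'v set) = d" and "0 < d"
    and "Vector_Spaces.linear scale scale phi" and "bij phi"
    and "is_filtration scale Fil"
    and "inj_on v {1..d}" and "module.independent scale (v ` {1..d})"
    and "module.span scale (v ` {1..d}) = UNIV"
    and "\<forall>k\<in>{1..d}. v k \<in> Fil (tHT scale Fil k)"
    and "\<exists>a b. J = {a..b}"
    and "{tHT scale Fil 1<..tHT'_d (tHT scale Fil 1) (tHT scale Fil d)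
            (newton_vals p iota nabsK (mat_of_map scale d v phi))} \<subseteq> J"
  shows "(\<forall>n\<ge>N. \<forall>i<d. \<forall>j<d. Hdvd nabs (fps_of_poly (omegaS p u n J))
            ((Zseq p u scale d v phi (tHT scale Fil) J N (Suc n)
              - Zseq p u scale d v phi (tHT scale Fil) J N n) $$ (i, j)))
       \<and> (\<forall>c :: nat \<Rightarrow> 'k. \<exists>w :: nat \<Rightarrow> 'k fps. \<forall>i<d.
            Hconv nabs (\<lambda>n. \<Sum>j<d. Zseq p u scale d v phi (tHT scale Fil) J N n $$ (i, j)
                                    * fps_const (c j)) (w i))
       \<and> (\<exists>Zinf :: 'k fps mat. Zinf \<in> carrier_mat d d
            \<and> (\<forall>i<d. \<forall>j<d. Hconv nabs (\<lambda>n. Zseq p u scale d v phi (tHT scale Fil) J N n $$ (i, j))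
                                    (Zinf $$ (i, j)))
            \<and> (\<exists>e. Hunit nabs e \<and> det Zinf
                 = e * (\<Prod>k\<in>{1..d}. Xi p nabs u N {tHT scale Fil k<..tHT scale Fil d} J)))"
proof -
  let ?A = "mat_of_map scale d v phi" and ?B = "mat_of_map scale d v (Hilbert_Choice.inv phi)"
  let ?t = "tHT scale Fil" and ?NV = "newton_vals p iota nabsK (mat_of_map scale d v phi)"
  let ?Js = "\<lambda>k. {?t (k + 1)<..?t d}"
  let ?\<Delta> = "Max ?NV - Min ?NV"
  let ?W = "real p powr ?\<Delta>"
  let ?S = "Zstep p u scale d v phi ?t J" and ?Z = "Zseq p u scale d v phi ?t J N"
  note phi = \<open>Vector_Spaces.linear scale scale phi\<close> \<open>bij phi\<close>
  note v = \<open>inj_on v {1..d}\<close> \<open>module.independent scale (v ` {1..d})\<close> \<open>module.span scale (v ` {1..d}) = UNIV\<close>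
  interpret padic_twist nabs p u
    using assms(1-4) by unfold_locales (auto simp: is_Qp_def)
  interpret V: vector_space scale by (rule assms)
  interpret F: finite_dimensional_vector_space scale "v ` {1..d}"
    by unfold_locales (use v in auto)
  have inv_linear: "Vector_Spaces.linear scale scale (Hilbert_Choice.inv phi)"
    by (rule V.linear_inv_of_bij[OF phi])
  have carr: "?A \<in> carrier_mat d d" "?B \<in> carrier_mat d d"
    by (simp_all add: mat_of_map_def)
  have "phi \<circ> Hilbert_Choice.inv phi = id"
    using phi(2) by (simp add: bij_is_surj surj_iff[symmetric])
  hence AB: "?A * ?B = 1\<^sub>m d"
    using V.mat_of_map_comp[OF v phi(1)] V.mat_of_map_id[OF v(1,2)] by metis
  note newton = mat_pow_newton_bound[OF assms(5) carr AB \<open>0 < d\<close> p_gt_1]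
  obtain C where C: "\<And>n i j k l. i < d \<Longrightarrow> j < d \<Longrightarrow> k < d \<Longrightarrow> l < d \<Longrightarrow>
      nabs ((?A ^\<^sub>m n) $$ (i, j)) * nabs ((?B ^\<^sub>m n) $$ (k, l)) \<le> C * ?W ^ n"
    using newton(3) by blast
  have "v ` {1..d} \<noteq> {}" using \<open>0 < d\<close> by auto
  hence size: "size (HT_mset scale Fil) = d"
    using F.size_HT_mset assms(7,11) by simp
  define t' where "t' = tHT'_d (?t 1) (?t d) ?NV"
  have t': "?t d \<le> t'" "?\<Delta> < real_of_int (t' - ?t 1)"
    unfolding t'_def by (rule tHT'_d_bounds)+
  have J_sup: "{?t 1<..t'} \<subseteq> J" using assms(17) by (simp add: t'_def)
  have J_fin: "finite J" using assms(16) by auto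
  \<comment> \<open>There is at least one eigenvalue, so the maximum is not below the minimum;
    \<open>t'\<close> then strictly exceeds the first weight and the interval is nonempty.\<close>
  have "0 \<le> ?\<Delta>" using newton(1,2) by simp
  hence "?t 1 < t'" using t'(2) by linarith
  hence J_ne: "J \<noteq> {}" using J_sup by auto
  have Js: "?Js k \<subseteq> J" if "k < d" for k
  proof -
    have "?t 1 \<le> ?t (k + 1)" using that by (intro tHT_mono[OF size]) auto
    thus ?thesis using J_sup t'(1) by force
  qed
  \<comment> \<open>The choice of \<open>t'\<close> pays off here: \<open>J\<close> has more than
    \<Delta> elements, which is the convergence condition on \<open>W\<close>.\<close>
  have "t' - ?t 1 \<le> int (card J)"
    using card_mono[OF J_fin J_sup] by simp
  hence "?\<Delta> < real (card J)" using t'(2) by linarith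
  hence "?W < real p powr real (card J)"
    using p_gt_1 by (intro powr_less_mono) auto
  hence W: "?W * (1 / p) ^ card J < 1"
    using p_gt_1 by (simp add: powr_realpow power_one_over field_simps)
  have S: "?S n = map_mat fps_const (?A ^\<^sub>m (n + 1))
      * mat d d (\<lambda>(i, j). if i = j then fps_of_poly (xitilde p u n (?Js i) J) else 0)
      * map_mat fps_const (?B ^\<^sub>m (n + 1))" for n
    unfolding Zstep_def Tmat_def V.mat_of_map_funpow[OF v phi(1)] V.mat_of_map_funpow[OF v inv_linear] ..
  have Z0: "?Z 0 = (if N = 0 then ?S 0 * 1\<^sub>m d else 1\<^sub>m d)"
    and ZSuc: "?Z (Suc n) = (if N \<le> Suc n then ?S (Suc n) * ?Z n else 1\<^sub>m d)" for n
    by simp_all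
  note result = twisted_product_limit[where Js = ?Js and S = ?S and Z = ?Z,
      OF J_fin J_ne Js carr AB _ W C S Z0 ZSuc]
  obtain L where L: "L \<in> carrier_mat d d"
    "\<And>i j. i < d \<Longrightarrow> j < d \<Longrightarrow> Hconv nabs (\<lambda>n. ?Z n $$ (i, j)) (L $$ (i, j))"
    "det L = (\<Prod>k<d. Xi p nabs u N (?Js k) J)"
    using result(2) by auto
  have "(\<Prod>k<d. Xi p nabs u N (?Js k) J) = (\<Prod>k\<in>{1..d}. Xi p nabs u N {?t k<..?t d} J)"
    by (rule prod.reindex_bij_witness[of _ "\<lambda>k. k - 1" Suc]) auto
  hence det: "det L = 1 * (\<Prod>k\<in>{1..d}. Xi p nabs u N {?t k<..?t d} J)"
    by (simp add: L(3))
  have unit: "Hunit nabs 1"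
    unfolding Hunit_def by (intro conjI exI[of _ 1]) simp_all
  \<comment> \<open>The \<open>c j\<close> are the coordinates of a vector of the filtered module,
    and the limit is \<open>L\<close> applied to it.\<close>
  have conv: "\<forall>i<d. Hconv nabs (\<lambda>n. \<Sum>j<d. ?Z n $$ (i, j) * fps_const (c j))
      (\<Sum>j<d. L $$ (i, j) * fps_const (c j))" for c
    using L(2) by (auto intro!: Hconv_sum Hconv_mult Hconv_const)
  show ?thesis
  proof (intro conjI allI impI)
    fix c :: "nat \<Rightarrow> 'k"
    show "\<exists>w. \<forall>i<d. Hconv nabs (\<lambda>n. \<Sum>j<d. ?Z n $$ (i, j) * fps_const (c j)) (w i)"
      by (rule exI[of _ "\<lambda>i. \<Sum>j<d. L $$ (i, j) * fps_const (c j)"]) (rule conv)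
  next
    show "\<exists>Zinf. Zinf \<in> carrier_mat d d
        \<and> (\<forall>i<d. \<forall>j<d. Hconv nabs (\<lambda>n. ?Z n $$ (i, j)) (Zinf $$ (i, j)))
        \<and> (\<exists>e. Hunit nabs e \<and> det Zinf = e * (\<Prod>k\<in>{1..d}. Xi p nabs u N {?t k<..?t d} J))"
      using L(1,2) det unit by blast
  qed (use result(1) in simp)
qed

end
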